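(* Let $p$ be a prime, let $c>1$ be a constant and set $\alpha_n=\frac{c\log n}{n}$. Let $(A(n))_{n\ge 1}$ be a sequence of random matrices with $A(n)\in \mathrm{M}_n(\mathbb{F}_p)$ for every $n\ge 1$, and assume that $A(n)$ is $\alpha_n$-balanced for all sufficiently large $n$. Then for every nonnegative integer $r$, $$\lim_{n\to\infty}\mathbb{E}\left(\#\mathrm{Sur}(\mathrm{cok}(A(n)),\mathbb{F}_p^r)\right)=1.$$
   Context: $\mathbb{F}_p$ is the field with $p$ elements and $\mathrm{M}_n(\mathbb{F}_p)$ is the set of $n\times n$ matrices over $\mathbb{F}_p$. For $A\in \mathrm{M}_n(\mathbb{F}_p)$, regarded as the linear map $\mathbb{F}_p^n\to\mathbb{F}_p^n$, $x\mapsto Ax$, the cokernel is $\mathrm{cok}(A):=\mathbb{F}_p^n/\mathrm{im}(A)$. $\mathrm{Sur}(B,C)$ denotes the set of surjective homomorphisms from $B$ to $C$. For a real number $\alpha>0$, a random element $x$ of $\mathbb{F}_p$ is $\alpha$-balanced if $\mathbb{P}(x=u)\le 1-\alpha$ for every $u\in\mathbb{F}_p$. A random matrix in $\mathrm{M}_n(\mathbb{F}_p)$ is $\alpha$-balanced if its entries are independent and each entry is $\alpha$-balanced; the entries are not required to be identically distributed. *)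

theory Defs
  imports
    "HOL-Probability.Probability"
    "HOL-Algebra.Coset"
    "Jordan_Normal_Form.Matrix"
    "Berlekamp_Zassenhaus.Finite_Field"
begin

text \<open>
  The field with \<open>p\<close> elements is the type \<open>'p mod_ring\<close> of integers modulo \<open>p = CARD('p)\<close>, where
  \<open>'p :: prime_card\<close> is an index type of prime cardinality.
\<close>

definition vec_group :: "nat \<Rightarrow> 'a::field Matrix.vec monoid" where
  "vec_group n = \<lparr>carrier = carrier_vec n, mult = (+), one = 0\<^sub>v n\<rparr>"

definition mat_im :: "'a::field mat \<Rightarrow> 'a Matrix.vec set" where
  "mat_im A = (\<lambda>x. A *\<^sub>v x) ` carrier_vec (dim_col A)"

definition cok :: "'a::field mat \<Rightarrow> 'a Matrix.vec set monoid" where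
  "cok A = vec_group (dim_row A) Mod mat_im A"

text \<open>
  Homomorphisms in \<^const>\<open>epi\<close> are unconstrained outside the carrier of the source; restricting them to
  extensional functions ensures that each surjection is counted once.
\<close>

definition Sur :: "('a, 'm) monoid_scheme \<Rightarrow> ('b, 'n) monoid_scheme \<Rightarrow> ('a \<Rightarrow> 'b) set" where
  "Sur B C = epi B C \<inter> extensional (carrier B)"

definition balanced_elem :: "real \<Rightarrow> 'w measure \<Rightarrow> ('w \<Rightarrow> 'a) \<Rightarrow> bool" where
  "balanced_elem \<alpha> M X \<longleftrightarrow> (\<forall>u. \<P>(\<omega> in M. X \<omega> = u) \<le> 1 - \<alpha>)"

definition random_mat :: "nat \<Rightarrow> 'w measure \<Rightarrow> ('w \<Rightarrow> 'a mat) \<Rightarrow> bool" where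
  "random_mat n M A \<longleftrightarrow> prob_space M \<and> A \<in> M \<rightarrow>\<^sub>M count_space (carrier_mat n n)"

definition balanced_mat :: "real \<Rightarrow> nat \<Rightarrow> 'w measure \<Rightarrow> ('w \<Rightarrow> 'a mat) \<Rightarrow> bool" where
  "balanced_mat \<alpha> n M A \<longleftrightarrow>
     random_mat n M A \<and>
     prob_space.indep_vars M (\<lambda>_. count_space UNIV) (\<lambda>(i, j) \<omega>. A \<omega> $$ (i, j)) ({..<n} \<times> {..<n}) \<and>
     (\<forall>i<n. \<forall>j<n. balanced_elem \<alpha> M (\<lambda>\<omega>. A \<omega> $$ (i, j)))"

end

theory Submission
  imports Defs "Berlekamp_Zassenhaus.Berlekamp_Type_Based" "HOL-Real_Asymp.Real_Asymp"
begin

text \<open>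
  A surjection from the cokernel of \<open>A\<close> onto \<open>GF(p)\<^sup>r\<close> is an \<open>r \<times> n\<close> matrix \<open>F\<close> of rank \<open>r\<close> with
  \<open>F A = 0\<close> (\<open>card_Sur_cok\<close>), and the columns of \<open>A\<close> are independent. With \<open>A\<^sub>j\<close> the columns of \<open>A\<close>,
  the expectation is therefore the sum of \<open>\<Prod>\<^sub>j P(F A\<^sub>j = 0)\<close> over all \<open>F\<close> of full rank. Throughout, \<open>F\<close> is given
  by its columns \<open>F 0, \<dots>, F (n - 1)\<close> in \<open>GF(p)\<^sup>r\<close>, and \<open>L = p\<^sup>r\<close>. Were every factor equal to \<open>1 / L\<close>,
  the sum would be the proportion of full rank matrices, which tends to 1. By Fourier inversion,
  \<open>P(F A\<^sub>j = 0)\<close> is the average over \<open>v\<close> in \<open>GF(p)\<^sup>r\<close> of the products over \<open>i\<close> of the characteristic functions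
  of the entries \<open>A\<^sub>i\<^sub>j\<close> at the points \<open>v \<bullet> F i\<close>.

  The theorem holds down to \<open>c > 1\<close>, so no constant may be lost. The sharp estimate for an
  \<open>\<alpha>\<close>-balanced entry (\<open>char_fun_le_exp_gap\<close>) is \<open>exp (- m * h t)\<close> with \<open>m = \<alpha> (1 - \<alpha>)\<close> and a function \<open>h\<close>
  between 0 and 2, vanishing at 0, bounded below by a constant \<open>\<kappa> > 0\<close> elsewhere, whose average over
  \<open>GF(p)\<close> is 1. For a typical \<open>F\<close> the values \<open>v \<bullet> F i\<close> are equidistributed, the sum of the \<open>h\<close> over \<open>i\<close>
  is about \<open>n\<close>, and each nonzero \<open>v\<close> contributes at most about \<open>exp (- m n)\<close>, that is \<open>n\<close> to the power \<open>- c\<close>.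
  After raising \<open>1 + L exp (- m n)\<close> to the power \<open>n\<close> this is still \<open>1 + o(1)\<close> exactly because \<open>c > 1\<close>.

  Atypical \<open>F\<close> are of two kinds. If all nontrivial row combinations have at least \<open>\<delta> n\<close> nonzero entries, the
  product is at most \<open>L\<close> to the power \<open>- n\<close> times \<open>exp (o(n))\<close>, while a Chernoff bound makes such \<open>F\<close>
  exponentially rare (\<open>card_gap_sum_small\<close>). Otherwise there is a subgroup \<open>K\<close> of combinations which is
  supported on a set \<open>I\<close> of at most \<open>L \<delta> n\<close> columns, such that every combination outside \<open>K\<close> has at least
  \<open>\<delta> n\<close> nonzero entries off \<open>I\<close> (\<open>ex_degenerate_subgroup\<close>). Averaging the Fourier sum over the cosets of \<open>K\<close> separates the two sets of columns
  (\<open>sum_exp_gap_le\<close>): off \<open>I\<close> the previous analysis applies with \<open>GF(p)\<^sup>r\<close> replaced by the annihilator of \<open>K\<close>, and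
  \<open>I\<close> costs the factor \<open>\<rho> = (1 + exp (- 2 m w)) / 2\<close> with \<open>w = card I\<close>, which is \<open>1 - m w\<close> to first order.
  The \<open>n\<close>-th power of \<open>\<rho>\<close> beats the number of choices of \<open>I\<close> together with the \<open>L\<close> to the power \<open>w\<close> choices of the columns on \<open>I\<close>:
  for small \<open>m w\<close> it is about \<open>n\<close> to the power \<open>- c w\<close>, and again \<open>c > 1\<close> suffices; for larger \<open>m w\<close> it is
  exponentially small and \<open>\<delta>\<close> is chosen so that the entropy of the sets \<open>I\<close> is smaller
  (\<open>sum_small_support_le\<close>, \<open>threshold_parameters\<close>).

  For the lower bound only the typical \<open>F\<close> are kept (\<open>sum_full_rank_ge\<close>).
\<close>

section \<open>Additive characters of the prime field\<close>

definition add_char :: "'p::prime_card mod_ring \<Rightarrow> complex" where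
  "add_char x = cis (2 * pi * real_of_int (to_int_mod_ring x) / real CARD('p))"

lemma add_char_of_int: "add_char (of_int k :: 'p::prime_card mod_ring) = cis (2 * pi * real_of_int k / real CARD('p))"
proof -
  let ?p = "int CARD('p)"
  have p: "?p > 0" using prime_card_int[where 'a='p] prime_gt_0_int by blast
  have "to_int_mod_ring (of_int k :: 'p mod_ring) = k mod ?p"
    by (metis of_int_mod_ring.rep_eq of_int_of_int_mod_ring to_int_mod_ring.rep_eq)
  moreover have "real_of_int k = real_of_int (k mod ?p) + real_of_int (k div ?p) * real_of_int ?p"
    by (metis add.commute div_mult_mod_eq of_int_add of_int_mult)
  ultimately have "2 * pi * real_of_int k / real CARD('p)
      = 2 * pi * real_of_int (to_int_mod_ring (of_int k :: 'p mod_ring)) / real CARD('p) + 2 * pi * real_of_int (k div ?p)"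
    using p by (simp add: field_simps)
  then show ?thesis unfolding add_char_def by (simp add: cis_mult [symmetric] cis_multiple_2pi)
qed

lemma of_int_to_int: "of_int (to_int_mod_ring x) = (x :: 'p::prime_card mod_ring)"
  by (simp add: of_int_of_int_mod_ring)

lemma add_char_add: "add_char (x + y) = add_char x * add_char (y :: 'p::prime_card mod_ring)"
proof -
  have "x + y = of_int (to_int_mod_ring x + to_int_mod_ring y)" by (simp add: of_int_to_int)
  then have "add_char (x + y) = cis (2 * pi * real_of_int (to_int_mod_ring x + to_int_mod_ring y) / real CARD('p))"
    by (simp only: add_char_of_int)
  then show ?thesis by (simp add: add_char_def cis_mult ring_distribs add_divide_distrib)
qed

lemma add_char_0 [simp]: "add_char 0 = 1" by (simp add: add_char_def)
lemma norm_add_char [simp]: "norm (add_char x) = 1" by (simp add: add_char_def)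

lemma Re_add_char_le: "Re (add_char x) \<le> 1" using complex_Re_le_cmod[of "add_char x"] by simp
lemma Re_add_char_ge: "Re (add_char x) \<ge> -1" using abs_Re_le_cmod[of "add_char x"] by simp

lemma add_char_sum: "add_char (\<Sum>i\<in>S. f i) = (\<Prod>i\<in>S. add_char (f i))"
  by (induction S rule: infinite_finite_induct) (auto simp: add_char_add)

lemma cnj_add_char: "cnj (add_char x) = add_char (- x)"
proof -
  have "add_char x * add_char (-x) = 1" by (simp flip: add_char_add)
  moreover have "add_char x * cnj (add_char x) = 1" by (simp add: complex_norm_square [symmetric])
  ultimately show ?thesis by (metis mult_cancel_left mult_zero_left zero_neq_one)
qed

lemma add_char_neq_1: assumes "x \<noteq> (0 :: 'p::prime_card mod_ring)" shows "add_char x \<noteq> 1"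
proof
  assume "add_char x = 1"
  let ?k = "to_int_mod_ring x" let ?p = "int CARD('p)"
  have k: "0 \<le> ?k" "?k < ?p" using range_to_int_mod_ring[where 'a='p] by auto
  have k0: "?k \<noteq> 0" using assms by (metis of_int_0 of_int_to_int)
  have "Re (add_char x) = 1" using \<open>add_char x = 1\<close> by simp
  then have "cos (2 * pi * real_of_int ?k / real CARD('p)) = 1" by (simp add: add_char_def)
  then obtain n where "2 * pi * real_of_int ?k / real CARD('p) = real_of_int n * 2 * pi"
    by (auto simp: cos_one_2pi_int)
  then have "real_of_int ?k = real_of_int n * real_of_int ?p"
    using k by (simp add: field_simps)
  then have "?k = n * ?p" by (metis of_int_eq_iff of_int_mult)
  then show False using k k0 by (metis mod_mult_self2_is_0 mod_pos_pos_trivial)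
qed

lemma ex_add_char_gap: "\<exists>\<kappa>>0. \<forall>x::'p::prime_card mod_ring. x \<noteq> 0 \<longrightarrow> \<kappa> \<le> 1 - Re (add_char x)"
proof -
  let ?S = "(\<lambda>x::'p mod_ring. 1 - Re (add_char x)) ` (UNIV - {0})"
  have pos: "y > 0" if "y \<in> ?S" for y
  proof -
    from that obtain x :: "'p mod_ring" where x: "x \<noteq> 0" "y = 1 - Re (add_char x)" by (elim imageE) simp
    have "Re (add_char x) \<noteq> 1"
    proof
      assume r: "Re (add_char x) = 1"
      have "(Re (add_char x))\<^sup>2 + (Im (add_char x))\<^sup>2 = 1" using cmod_power2[of "add_char x"] by simp
      then have "Im (add_char x) = 0" using r by simp
      then show False using r add_char_neq_1[OF x(1)] by (simp add: complex_eq_iff)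
    qed
    then show ?thesis using x Re_add_char_le[of x] by simp
  qed
  have fin: "finite ?S" by simp
  have ne: "?S \<noteq> {}" by (auto intro!: exI[of _ 1])
  show ?thesis
    by (rule exI[of _ "Min ?S"]) (use fin ne pos in \<open>auto simp: Min_gr_iff\<close>)
qed

section \<open>Duality for subgroups of vectors\<close>

text \<open>
  Over the prime field, closure under negation is automatic, since every vector has order dividing \<open>p\<close>.
\<close>

definition vec_subgrp :: "nat \<Rightarrow> 'a::field Matrix.vec set \<Rightarrow> bool" where
  "vec_subgrp r K \<longleftrightarrow> K \<subseteq> carrier_vec r \<and> 0\<^sub>v r \<in> K \<and> (\<forall>u\<in>K. \<forall>v\<in>K. u + v \<in> K)"

definition annih :: "nat \<Rightarrow> 'a::field Matrix.vec set \<Rightarrow> 'a Matrix.vec set" where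
  "annih r K = {y \<in> carrier_vec r. \<forall>u\<in>K. scalar_prod u y = 0}"

lemma finite_subgrp: "vec_subgrp r (K :: 'p::prime_card mod_ring Matrix.vec set) \<Longrightarrow> finite K"
  by (meson finite_carrier_vec finite_subset vec_subgrp_def)

lemma subgrp_carrier: "vec_subgrp r (carrier_vec r)" by (auto simp: vec_subgrp_def)

lemma subgrp_annih: "vec_subgrp r K \<Longrightarrow> vec_subgrp r (annih r K)"
  by (auto simp: vec_subgrp_def annih_def subset_iff scalar_prod_add_distrib[where n=r])

lemma subgrp_translate:
  assumes K: "vec_subgrp r (K :: 'p::prime_card mod_ring Matrix.vec set)" and w: "w \<in> K"
  shows "(\<lambda>u. u + w) ` K = K"
proof (rule card_subset_eq)
  show "finite K" using K by (rule finite_subgrp)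
  show "(\<lambda>u. u + w) ` K \<subseteq> K" using K w by (auto simp: vec_subgrp_def)
  have "inj_on (\<lambda>u. u + w) K"
  proof
    fix x y assume "x \<in> K" "y \<in> K" "x + w = y + w"
    moreover from this have c: "x \<in> carrier_vec r" "y \<in> carrier_vec r" "w \<in> carrier_vec r"
      using K w by (auto simp: vec_subgrp_def)
    ultimately have "vec_index x i + vec_index w i = vec_index y i + vec_index w i" if "i < r" for i
      using that by (metis index_add_vec(1) carrier_vecD)
    then show "x = y" using c by (intro eq_vecI) auto
  qed
  then show "card ((\<lambda>u. u + w) ` K) = card K" by (rule card_image)
qed

text \<open>
  Translating by \<open>w\<close> permutes \<open>K\<close> and multiplies the sum by a root of unity different from 1.
\<close>

lemma sum_add_char_subgrp:
  assumes K: "vec_subgrp r (K :: 'p::prime_card mod_ring Matrix.vec set)"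
    and y: "y \<in> carrier_vec r" and w: "w \<in> K" "scalar_prod w y \<noteq> 0" and d: "d \<noteq> 0"
  shows "(\<Sum>u\<in>K. add_char (d * scalar_prod u y)) = 0"
proof -
  let ?S = "\<Sum>u\<in>K. add_char (d * scalar_prod u y)"
  have inj: "inj_on (\<lambda>u. u + w) K"
    using subgrp_translate[OF K w(1)] finite_subgrp[OF K] by (metis eq_card_imp_inj_on)
  have "?S = (\<Sum>u\<in>(\<lambda>u. u + w) ` K. add_char (d * scalar_prod u y))"
    using subgrp_translate[OF K w(1)] by simp
  also have "\<dots> = (\<Sum>u\<in>K. add_char (d * scalar_prod (u + w) y))"
    using inj by (simp add: sum.reindex)
  also have "\<dots> = (\<Sum>u\<in>K. add_char (d * scalar_prod u y) * add_char (d * scalar_prod w y))"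
  proof (rule sum.cong[OF refl])
    fix u assume "u \<in> K"
    then have "scalar_prod (u + w) y = scalar_prod u y + scalar_prod w y"
      using K y w by (intro add_scalar_prod_distrib) (auto simp: vec_subgrp_def)
    then show "add_char (d * scalar_prod (u + w) y) = add_char (d * scalar_prod u y) * add_char (d * scalar_prod w y)"
      by (simp add: add_char_add ring_distribs)
  qed
  also have "\<dots> = ?S * add_char (d * scalar_prod w y)" by (simp add: sum_distrib_right)
  finally have "?S * (1 - add_char (d * scalar_prod w y)) = 0" by (simp add: algebra_simps)
  moreover have "add_char (d * scalar_prod w y) \<noteq> 1" using d w by (intro add_char_neq_1) simp
  ultimately show ?thesis by simp
qed

lemma ex_scalar_prod_nonzero:
  assumes "y \<in> carrier_vec r" "y \<noteq> 0\<^sub>v r"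
  shows "\<exists>v\<in>carrier_vec r. scalar_prod v (y :: 'a::field Matrix.vec) \<noteq> 0"
proof -
  obtain i where i: "i < r" "vec_index y i \<noteq> 0" using assms by (auto simp: vec_eq_iff)
  then show ?thesis using assms scalar_prod_left_unit[OF assms(1) i(1)]
    by (intro bexI[of _ "unit_vec r i"]) auto
qed

text \<open>
  Double count the sum of the characters \<open>add_char (u \<bullet> y)\<close> over \<open>u\<close> in \<open>K\<close> and all \<open>y\<close>: summing over \<open>y\<close> first, only
  \<open>u = 0\<close> survives; summing over \<open>u\<close> first, only \<open>y\<close> in the annihilator survive.
\<close>

lemma card_annih:
  assumes K: "vec_subgrp r (K :: 'p::prime_card mod_ring Matrix.vec set)"
  shows "card K * card (annih r K) = CARD('p) ^ r"
proof -
  let ?G = "carrier_vec r :: 'p mod_ring Matrix.vec set"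
  have "(\<Sum>u\<in>K. \<Sum>y\<in>?G. add_char (scalar_prod u y)) = (\<Sum>u\<in>K. if u = 0\<^sub>v r then of_nat (card ?G) else 0)"
  proof (rule sum.cong[OF refl])
    fix u assume u: "u \<in> K"
    then have uc: "u \<in> carrier_vec r" using K by (auto simp: vec_subgrp_def)
    show "(\<Sum>y\<in>?G. add_char (scalar_prod u y)) = (if u = 0\<^sub>v r then of_nat (card ?G) else 0)"
    proof (cases "u = 0\<^sub>v r")
      case True then show ?thesis by simp
    next
      case False
      obtain v where v: "v \<in> ?G" "scalar_prod v u \<noteq> 0" using ex_scalar_prod_nonzero[OF uc False] by auto
      have "(\<Sum>y\<in>?G. add_char (1 * scalar_prod y u)) = 0"
        by (rule sum_add_char_subgrp[OF subgrp_carrier uc v]) simp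
      moreover have "(\<Sum>y\<in>?G. add_char (1 * scalar_prod y u)) = (\<Sum>y\<in>?G. add_char (scalar_prod u y))"
        using uc by (intro sum.cong) (auto simp: comm_scalar_prod[of _ r])
      ultimately show ?thesis using False by simp
    qed
  qed
  also have "\<dots> = of_nat (card ?G)"
    using K finite_subgrp[OF K] by (simp add: vec_subgrp_def)
  finally have 1: "(\<Sum>u\<in>K. \<Sum>y\<in>?G. add_char (scalar_prod u y)) = of_nat (card ?G)" .
  have "(\<Sum>y\<in>?G. \<Sum>u\<in>K. add_char (scalar_prod u y)) = (\<Sum>y\<in>?G. if y \<in> annih r K then of_nat (card K) else 0)"
  proof (rule sum.cong[OF refl])
    fix y assume y: "y \<in> ?G"
    show "(\<Sum>u\<in>K. add_char (scalar_prod u y)) = (if y \<in> annih r K then of_nat (card K) else 0)"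
    proof (cases "y \<in> annih r K")
      case True then show ?thesis by (simp add: annih_def)
    next
      case False
      then obtain w where "w \<in> K" "scalar_prod w y \<noteq> 0" using y by (auto simp: annih_def)
      then show ?thesis using sum_add_char_subgrp[OF K y, of w 1] False by simp
    qed
  qed
  also have "\<dots> = of_nat (card (annih r K)) * of_nat (card K)"
  proof -
    have "{y \<in> ?G. y \<in> annih r K} = annih r K" by (auto simp: annih_def)
    then show ?thesis by (simp add: sum.If_cases Int_def)
  qed
  finally have "of_nat (card (annih r K)) * of_nat (card K) = (of_nat (card ?G) :: complex)"
    using 1 sum.swap[of "\<lambda>u y. add_char (scalar_prod u y)" ?G K] by simp
  then have "card (annih r K) * card K = card ?G"
    by (metis of_nat_eq_iff of_nat_mult)
  then show ?thesis by (simp add: card_carrier_vec mult.commute)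
qed

lemma annih_annih:
  assumes K: "vec_subgrp r (K :: 'p::prime_card mod_ring Matrix.vec set)"
  shows "annih r (annih r K) = K"
proof (rule sym, rule card_subset_eq)
  show "finite (annih r (annih r K))" by (intro finite_subgrp[of r] subgrp_annih K)
  show "K \<subseteq> annih r (annih r K)"
  proof
    fix u assume u: "u \<in> K"
    then have uc: "u \<in> carrier_vec r" using K by (auto simp: vec_subgrp_def)
    moreover have "scalar_prod y u = 0" if "y \<in> annih r K" for y
      using that u comm_scalar_prod[of y r u] uc by (auto simp: annih_def)
    ultimately show "u \<in> annih r (annih r K)" by (simp add: annih_def)
  qed
  have "card K * card (annih r K) = card (annih r (annih r K)) * card (annih r K)"
    using card_annih[OF K] card_annih[OF subgrp_annih[OF K]] by (simp add: mult.commute)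
  moreover have "annih r K \<noteq> {}" using subgrp_annih[OF K] by (auto simp: vec_subgrp_def)
  then have "card (annih r K) > 0" using finite_subgrp[OF subgrp_annih[OF K]] by (simp add: card_gt_0_iff)
  ultimately show "card K = card (annih r (annih r K))" by simp
qed

lemma sum_add_char_annih:
  assumes K: "vec_subgrp r (K :: 'p::prime_card mod_ring Matrix.vec set)"
    and v: "v \<in> carrier_vec r" "v \<notin> K" and d: "d \<noteq> 0"
  shows "(\<Sum>y\<in>annih r K. add_char (d * scalar_prod v y)) = 0"
proof -
  obtain w where w: "w \<in> annih r K" "scalar_prod w v \<noteq> 0"
    using v annih_annih[OF K] unfolding annih_def[of r "annih r K"] by auto
  have "(\<Sum>y\<in>annih r K. add_char (d * scalar_prod y v)) = 0"
    by (rule sum_add_char_subgrp[OF subgrp_annih[OF K] v(1) w d])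
  moreover have "(\<Sum>y\<in>annih r K. add_char (d * scalar_prod y v)) = (\<Sum>y\<in>annih r K. add_char (d * scalar_prod v y))"
    using v by (intro sum.cong) (auto simp: comm_scalar_prod[of _ r] annih_def)
  ultimately show ?thesis by simp
qed

section \<open>Characteristic functions of balanced entries\<close>

text \<open>
  The characteristic function (Fourier transform) of a random element of the field with
  point probabilities \<open>q\<close>.
\<close>

definition char_fun :: "('p::prime_card mod_ring \<Rightarrow> real) \<Rightarrow> 'p mod_ring \<Rightarrow> complex" where
  "char_fun q t = (\<Sum>u\<in>UNIV. of_real (q u) * add_char (t * u))"

text \<open>
  A distribution of the difference of two independent copies of an entry, conditioned on being
  nonzero, has this form.
\<close>

definition step_dist :: "('p::prime_card mod_ring \<Rightarrow> real) \<Rightarrow> bool" where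
  "step_dist \<rho> \<longleftrightarrow> (\<forall>d. \<rho> d \<ge> 0) \<and> \<rho> 0 = 0 \<and> (\<Sum>d\<in>UNIV. \<rho> d) = 1"

text \<open>
  If \<open>D\<close> has distribution \<open>\<rho>\<close>, this is 1 minus the real part of the characteristic function of \<open>D\<close>. It
  measures how much a random entry decorrelates the character at frequency \<open>t\<close>.
\<close>

definition gap :: "('p::prime_card mod_ring \<Rightarrow> real) \<Rightarrow> 'p mod_ring \<Rightarrow> real" where
  "gap \<rho> t = (\<Sum>d\<in>UNIV. \<rho> d * (1 - Re (add_char (d * t))))"

lemma gap_nonneg: "step_dist \<rho> \<Longrightarrow> 0 \<le> gap \<rho> t"
  by (auto simp: gap_def step_dist_def Re_add_char_le intro!: sum_nonneg mult_nonneg_nonneg)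

lemma gap_le_2: assumes "step_dist \<rho>" shows "gap \<rho> t \<le> 2"
proof -
  have "gap \<rho> t \<le> (\<Sum>d\<in>UNIV. \<rho> d * 2)"
    unfolding gap_def using assms
  proof (intro sum_mono mult_left_mono)
    fix d show "1 - Re (add_char (d * t)) \<le> 2" using Re_add_char_ge[of "d * t"] by simp
  qed (auto simp: step_dist_def)
  also have "\<dots> = 2" using assms by (simp add: step_dist_def flip: sum_distrib_right)
  finally show ?thesis .
qed

lemma gap_0 [simp]: "gap \<rho> 0 = 0" by (simp add: gap_def)

lemma gap_ge:
  assumes "step_dist \<rho>" "t \<noteq> 0" and \<kappa>: "\<And>x. x \<noteq> 0 \<Longrightarrow> \<kappa> \<le> 1 - Re (add_char (x :: 'p::prime_card mod_ring))"
  shows "\<kappa> \<le> gap \<rho> (t :: 'p mod_ring)"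
proof -
  have "\<kappa> = (\<Sum>d\<in>UNIV. \<rho> d * \<kappa>)" using assms by (simp add: step_dist_def flip: sum_distrib_right)
  also have "\<dots> \<le> gap \<rho> t" unfolding gap_def
  proof (rule sum_mono)
    fix d show "\<rho> d * \<kappa> \<le> \<rho> d * (1 - Re (add_char (d * t)))"
    proof (cases "d = 0")
      case True then show ?thesis using assms(1) by (simp add: step_dist_def)
    next
      case False then show ?thesis using assms by (intro mult_left_mono \<kappa>) (auto simp: step_dist_def)
    qed
  qed
  finally show ?thesis .
qed

text \<open>
  The squared modulus of the characteristic function is the characteristic function of the difference
  of two independent copies. The difference is nonzero with probability \<open>s = 1 - (\<Sum>u\<in>UNIV. q u * q u)\<close>, so the
  squared modulus is \<open>1 - s * gap \<rho> t\<close> with \<open>\<rho>\<close> the law of the difference conditioned on being nonzero. The bound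
  \<open>s \<ge> 2 \<alpha> (1 - \<alpha>)\<close> is what makes the constant sharp: it gains a factor of nearly 2 over the
  immediate \<open>s \<ge> \<alpha>\<close>, and this compensates the square root taken at the end. Conditioning on a nonzero difference
  normalises the average of \<open>gap \<rho>\<close> to 1 while keeping it at most 2, however far \<open>q\<close> is from the extremal distribution.
\<close>

lemma char_fun_le_exp_gap:
  fixes q :: "'p::prime_card mod_ring \<Rightarrow> real"
  assumes q: "\<And>u. 0 \<le> q u" "(\<Sum>u\<in>UNIV. q u) = 1" "\<And>u. q u \<le> 1 - \<alpha>" and \<alpha>: "0 < \<alpha>" "\<alpha> \<le> 1/2"
  shows "\<exists>\<rho>. step_dist \<rho> \<and> (\<forall>t. norm (char_fun q t) \<le> exp (- (\<alpha> * (1 - \<alpha>) * gap \<rho> t)))"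
proof -
  define Q where "Q d = (\<Sum>u\<in>UNIV. q u * q (u + d))" for d
  define s where "s = 1 - Q 0"
  define \<rho> where "\<rho> d = (if d = 0 then 0 else Q d / s)" for d
  have Q0: "Q d \<ge> 0" for d unfolding Q_def by (intro sum_nonneg mult_nonneg_nonneg q)
  have shift: "(\<Sum>d\<in>UNIV. f (u + d)) = (\<Sum>d\<in>UNIV. f d)" for f :: "'p mod_ring \<Rightarrow> 'b::comm_monoid_add" and u
    by (rule sum.reindex_bij_witness[of _ "\<lambda>d. d - u" "\<lambda>d. u + d"]) auto
  have sumQ: "(\<Sum>d\<in>UNIV. Q d) = 1"
  proof -
    have "(\<Sum>d\<in>UNIV. Q d) = (\<Sum>u\<in>UNIV. \<Sum>d\<in>UNIV. q u * q (u + d))"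
      unfolding Q_def by (rule sum.swap)
    also have "\<dots> = 1" by (simp add: shift q flip: sum_distrib_left)
    finally show ?thesis .
  qed
  \<comment> \<open>Let \<open>M\<close> be the largest point probability. The collision probability \<open>Q 0\<close> is at most \<open>1 / 2\<close> if \<open>M \<le> 1 / 2\<close>, and at most \<open>M\<^sup>2 + (1 - M)\<^sup>2\<close> otherwise.\<close>
  have s: "2 * \<alpha> * (1 - \<alpha>) \<le> s"
  proof -
    obtain u0 where u0: "\<And>u. q u \<le> q u0"
    proof -
      have "Max (range q) \<in> range q" by (intro Max_in) auto
      then obtain u0 where "Max (range q) = q u0" by (auto simp: image_def)
      then have "q u \<le> q u0" for u by (metis Max_ge finite finite_imageI rangeI)
      then show ?thesis by (rule that)
    qed
    have rest: "(\<Sum>u\<in>UNIV - {u0}. q u) = 1 - q u0"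
      using q(2) by (subst (asm) sum.remove[of _ u0]) auto
    have Qs: "Q 0 = q u0 * q u0 + (\<Sum>u\<in>UNIV - {u0}. q u * q u)"
      unfolding Q_def by (subst sum.remove[of _ u0]) auto
    show ?thesis
    proof (cases "q u0 \<le> 1 / 2")
      case True
      have "Q 0 \<le> (\<Sum>u\<in>UNIV. q u * (1 / 2))" unfolding Q_def
        by (intro sum_mono mult_left_mono) (use order_trans[OF u0 True] q in auto)
      then have "Q 0 \<le> 1/2" by (simp add: q flip: sum_divide_distrib)
      moreover have "2 * \<alpha> * (1 - \<alpha>) \<le> 1/2" using zero_le_power2[of "\<alpha> - 1/2"]
        by (simp add: power2_eq_square algebra_simps)
      ultimately show ?thesis by (simp add: s_def)
    next
      case False
      have "(\<Sum>u\<in>UNIV - {u0}. q u * q u) \<le> (\<Sum>u\<in>UNIV - {u0}. q u * (1 - q u0))"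
      proof (intro sum_mono mult_left_mono)
        fix u assume u: "u \<in> UNIV - {u0}"
        have "q u \<le> (\<Sum>u\<in>UNIV - {u0}. q u)" by (rule member_le_sum[OF u]) (auto simp: q)
        then show "q u \<le> 1 - q u0" by (simp add: rest)
      qed (auto simp: q)
      then have "Q 0 \<le> q u0 * q u0 + (1 - q u0) * (1 - q u0)"
        by (simp add: Qs rest flip: sum_distrib_right)
      then have "s \<ge> 2 * (q u0 * (1 - q u0))" by (simp add: s_def algebra_simps)
      moreover have "q u0 * (1 - q u0) - \<alpha> * (1 - \<alpha>) = (q u0 - \<alpha>) * (1 - \<alpha> - q u0)"
        by (simp add: algebra_simps)
      moreover have "(q u0 - \<alpha>) * (1 - \<alpha> - q u0) \<ge> 0"
        using False \<alpha> q(3)[of u0] by (intro mult_nonneg_nonneg) auto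
      ultimately show ?thesis by linarith
    qed
  qed
  have m: "0 < \<alpha> * (1 - \<alpha>)" using \<alpha> by simp
  then have spos: "s > 0" using s by linarith
  have sum_rest: "(\<Sum>d\<in>UNIV - {0}. Q d) = s"
    using sumQ by (subst (asm) sum.remove[of _ 0]) (auto simp: s_def)
  have "(\<Sum>d\<in>UNIV. \<rho> d) = (\<Sum>d\<in>UNIV - {0}. Q d / s)"
    unfolding \<rho>_def by (subst sum.remove[of _ 0]) auto
  then have dist: "step_dist \<rho>"
    using spos Q0 sum_rest by (auto simp: step_dist_def \<rho>_def simp flip: sum_divide_distrib)
  have "norm (char_fun q t) \<le> exp (- (\<alpha> * (1 - \<alpha>) * gap \<rho> t))" for t
  proof -
    have "complex_of_real ((norm (char_fun q t))\<^sup>2) = char_fun q t * cnj (char_fun q t)" by (simp only: complex_norm_square)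
    also have "\<dots> = (\<Sum>u\<in>UNIV. of_real (q u) * add_char (t * u)) * (\<Sum>u'\<in>UNIV. of_real (q u') * add_char (- (t * u')))"
      by (simp add: char_fun_def cnj_add_char)
    also have "\<dots> = (\<Sum>u'\<in>UNIV. \<Sum>u\<in>UNIV. of_real (q u' * q u) * add_char (t * (u' - u)))"
      by (simp add: sum_product mult_ac right_diff_distrib flip: add_char_add)
    also have "\<dots> = (\<Sum>u\<in>UNIV. \<Sum>u'\<in>UNIV. of_real (q u * q u') * add_char (t * (u' - u)))"
      by (subst sum.swap) (simp add: mult.commute)
    also have "\<dots> = (\<Sum>u\<in>UNIV. \<Sum>d\<in>UNIV. of_real (q u * q (u + d)) * add_char (t * d))"
    proof (rule sum.cong[OF refl])
      fix u show "(\<Sum>u'\<in>UNIV. of_real (q u * q u') * add_char (t * (u' - u))) = (\<Sum>d\<in>UNIV. of_real (q u * q (u + d)) * add_char (t * d))"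
        using shift[of "\<lambda>u'. of_real (q u * q u') * add_char (t * (u' - u))" u] by simp
    qed
    also have "\<dots> = (\<Sum>d\<in>UNIV. of_real (Q d) * add_char (d * t))"
      unfolding Q_def by (subst sum.swap) (simp add: sum_distrib_left sum_distrib_right mult.commute)
    finally have "(norm (char_fun q t))\<^sup>2 = (\<Sum>d\<in>UNIV. Q d * Re (add_char (d * t)))"
      by (simp add: complex_eq_iff)
    also have "\<dots> = 1 - (\<Sum>d\<in>UNIV. Q d * (1 - Re (add_char (d * t))))"
      by (simp add: right_diff_distrib sum_subtractf sumQ)
    also have "(\<Sum>d\<in>UNIV. Q d * (1 - Re (add_char (d * t)))) = s * gap \<rho> t"
      unfolding gap_def sum_distrib_left using spos by (intro sum.cong) (auto simp: \<rho>_def)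
    also have "1 - s * gap \<rho> t \<le> 1 - (2 * \<alpha> * (1 - \<alpha>)) * gap \<rho> t"
      using s gap_nonneg[OF dist, of t] by (simp add: mult_right_mono)
    also have "\<dots> \<le> exp (- ((2 * \<alpha> * (1 - \<alpha>)) * gap \<rho> t))"
      using exp_ge_add_one_self[of "- ((2 * \<alpha> * (1 - \<alpha>)) * gap \<rho> t)"] by simp
    also have "\<dots> = (exp (- (\<alpha> * (1 - \<alpha>) * gap \<rho> t)))\<^sup>2"
      by (simp add: power2_eq_square algebra_simps flip: exp_add)
    finally show ?thesis by (rule power2_le_imp_le) simp
  qed
  with dist show ?thesis by blast
qed

text \<open>
  Along every coset of a subgroup that does not annihilate \<open>y\<close>, each nontrivial character averages
  to 0, so the gap averages to exactly 1.
\<close>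

lemma sum_gap_subgrp:
  assumes K: "vec_subgrp r (K :: 'p::prime_card mod_ring Matrix.vec set)" and \<rho>: "step_dist \<rho>"
    and y: "y \<in> carrier_vec r" and v: "v \<in> carrier_vec r" and w: "w \<in> K" "scalar_prod w y \<noteq> 0"
  shows "(\<Sum>u\<in>K. gap \<rho> (scalar_prod (u + v) y)) = card K"
proof -
  have *: "(\<Sum>u\<in>K. \<rho> d * (1 - Re (add_char (d * scalar_prod (u + v) y)))) = \<rho> d * card K" for d
  proof (cases "d = 0")
    case True then show ?thesis using \<rho> by (simp add: step_dist_def)
  next
    case False
    have "(\<Sum>u\<in>K. add_char (d * scalar_prod (u + v) y)) = (\<Sum>u\<in>K. add_char (d * scalar_prod u y) * add_char (d * scalar_prod v y))"
    proof (rule sum.cong[OF refl])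
      fix u assume "u \<in> K"
      then have "scalar_prod (u + v) y = scalar_prod u y + scalar_prod v y"
        using K y v by (intro add_scalar_prod_distrib) (auto simp: vec_subgrp_def)
      then show "add_char (d * scalar_prod (u + v) y) = add_char (d * scalar_prod u y) * add_char (d * scalar_prod v y)"
        by (simp add: add_char_add ring_distribs)
    qed
    also have "\<dots> = 0" using sum_add_char_subgrp[OF K y w False] by (simp flip: sum_distrib_right)
    finally have "Re (\<Sum>u\<in>K. add_char (d * scalar_prod (u + v) y)) = 0" by simp
    then show ?thesis by (simp add: sum_subtractf flip: sum_distrib_left)
  qed
  have "(\<Sum>u\<in>K. gap \<rho> (scalar_prod (u + v) y)) = (\<Sum>d\<in>UNIV. \<Sum>u\<in>K. \<rho> d * (1 - Re (add_char (d * scalar_prod (u + v) y))))"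
    unfolding gap_def by (rule sum.swap)
  also have "\<dots> = (\<Sum>d\<in>UNIV. \<rho> d) * card K" by (simp only: * sum_distrib_right)
  finally show ?thesis using \<rho> by (simp add: step_dist_def)
qed

text \<open>
  The dual averaging: a frequency outside \<open>K\<close> is a nontrivial functional on the annihilator of \<open>K\<close>. This
  says that the gaps have mean 1 for random columns taken from the annihilator.
\<close>

lemma sum_gap_annih:
  assumes K: "vec_subgrp r (K :: 'p::prime_card mod_ring Matrix.vec set)" and \<rho>: "step_dist \<rho>"
    and v: "v \<in> carrier_vec r" "v \<notin> K"
  shows "(\<Sum>y\<in>annih r K. gap \<rho> (scalar_prod v y)) = card (annih r K)"
proof -
  have *: "(\<Sum>y\<in>annih r K. \<rho> d * (1 - Re (add_char (d * scalar_prod v y)))) = \<rho> d * card (annih r K)" for d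
  proof (cases "d = 0")
    case True then show ?thesis using \<rho> by (simp add: step_dist_def)
  next
    case False
    then have "Re (\<Sum>y\<in>annih r K. add_char (d * scalar_prod v y)) = 0" using sum_add_char_annih[OF K v] by simp
    then show ?thesis by (simp add: sum_subtractf flip: sum_distrib_left)
  qed
  have "(\<Sum>y\<in>annih r K. gap \<rho> (scalar_prod v y)) = (\<Sum>d\<in>UNIV. \<Sum>y\<in>annih r K. \<rho> d * (1 - Re (add_char (d * scalar_prod v y))))"
    unfolding gap_def by (rule sum.swap)
  also have "\<dots> = (\<Sum>d\<in>UNIV. \<rho> d) * card (annih r K)" by (simp only: * sum_distrib_right)
  finally show ?thesis using \<rho> by (simp add: step_dist_def)
qed

section \<open>Row combinations of low weight\<close>

lemma card_vec: "card (carrier_vec r :: 'p::prime_card mod_ring Matrix.vec set) = CARD('p) ^ r"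
  by (simp add: card_carrier_vec)

text \<open>
  The joint support of the row combinations \<open>w\<close> of \<open>F\<close> with \<open>w\<close> in \<open>K\<close>.
\<close>

definition active :: "nat \<Rightarrow> 'a::field Matrix.vec set \<Rightarrow> (nat \<Rightarrow> 'a Matrix.vec) \<Rightarrow> nat set" where
  "active n K F = {i. i < n \<and> (\<exists>w\<in>K. scalar_prod w (F i) \<noteq> 0)}"

lemma exp_chord:
  assumes "0 \<le> x" "x \<le> X" "0 < X" shows "exp (- m * x) \<le> 1 - x / X * (1 - exp (- m * X :: real))"
proof -
  have "exp ((1 - x / X) *\<^sub>R 0 + (x / X) *\<^sub>R (- m * X)) \<le> (1 - x / X) * exp 0 + (x / X) * exp (- m * X)"
    using assms by (intro convex_onD[OF exp_convex]) auto
  then show ?thesis using assms by (simp add: algebra_simps)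
qed

text \<open>
  The exponent, as a function of \<open>u\<close>, lies between 0 and \<open>2 * card I\<close> and has mean \<open>card I\<close>. By convexity of the
  exponential the average is largest when both extreme values are taken half of the time, as
  happens for \<open>p = 2\<close> and \<open>K\<close> of order 2.
\<close>

lemma sum_exp_translate_le:
  fixes m :: real
  assumes K: "vec_subgrp r (K :: 'p::prime_card mod_ring Matrix.vec set)" and \<rho>: "\<And>i. i \<in> I \<Longrightarrow> step_dist (\<rho> i)"
    and F: "\<And>i. i \<in> I \<Longrightarrow> F i \<in> carrier_vec r" and I: "finite I" "\<And>i. i \<in> I \<Longrightarrow> \<exists>w\<in>K. scalar_prod w (F i) \<noteq> 0"
    and v: "v \<in> carrier_vec r" 
  shows "(\<Sum>u\<in>K. exp (- m * (\<Sum>i\<in>I. gap (\<rho> i) (scalar_prod (u + v) (F i)))))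
    \<le> card K * ((1 + exp (- 2 * m * card I)) / 2)"
proof (cases "I = {}")
  case True then show ?thesis by simp
next
  case False
  define x where "x u = (\<Sum>i\<in>I. gap (\<rho> i) (scalar_prod (u + v) (F i)))" for u
  have cI: "0 < card I" using False I by (simp add: card_gt_0_iff)
  have x: "0 \<le> x u" "x u \<le> 2 * card I" for u
  proof -
    show "0 \<le> x u" unfolding x_def by (intro sum_nonneg gap_nonneg \<rho>)
    have "x u \<le> (\<Sum>i\<in>I. 2)" unfolding x_def by (intro sum_mono gap_le_2 \<rho>)
    then show "x u \<le> 2 * card I" by simp
  qed
  have "(\<Sum>u\<in>K. x u) = (\<Sum>i\<in>I. \<Sum>u\<in>K. gap (\<rho> i) (scalar_prod (u + v) (F i)))"
    unfolding x_def by (rule sum.swap)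
  also have "\<dots> = (\<Sum>i\<in>I. real (card K))"
  proof (rule sum.cong[OF refl])
    fix i assume i: "i \<in> I"
    then obtain w where "w \<in> K" "scalar_prod w (F i) \<noteq> 0" using I by blast
    then show "(\<Sum>u\<in>K. gap (\<rho> i) (scalar_prod (u + v) (F i))) = card K"
      by (rule sum_gap_subgrp[OF K \<rho>[OF i] F[OF i] v])
  qed
  finally have sx: "(\<Sum>u\<in>K. x u) = real (card I) * real (card K)" by simp
  have "(\<Sum>u\<in>K. exp (- m * x u)) \<le> (\<Sum>u\<in>K. 1 - x u / (2 * card I) * (1 - exp (- m * (2 * card I))))"
    using x cI by (intro sum_mono exp_chord) auto
  also have "\<dots> = card K - (\<Sum>u\<in>K. x u) / (2 * card I) * (1 - exp (- m * (2 * card I)))"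
    by (simp add: sum_subtractf flip: sum_distrib_right sum_divide_distrib)
  also have "\<dots> = card K * ((1 + exp (- 2 * m * card I)) / 2)"
    using cI by (simp add: sx field_simps)
  finally show ?thesis by (simp add: x_def)
qed

text \<open>
  Columns outside \<open>active n K F\<close> do not see a translation of \<open>v\<close> by \<open>K\<close>. Averaging over the coset of \<open>v\<close>
  therefore affects only the active columns, and there it yields the convexity bound.
\<close>

lemma sum_exp_gap_le:
  fixes m :: real
  assumes K: "vec_subgrp r (K :: 'p::prime_card mod_ring Matrix.vec set)" and \<rho>: "\<And>i. i < n \<Longrightarrow> step_dist (\<rho> i)"
    and F: "\<And>i. i < n \<Longrightarrow> F i \<in> carrier_vec r"
  shows "(\<Sum>v\<in>carrier_vec r. exp (- m * (\<Sum>i<n. gap (\<rho> i) (scalar_prod v (F i)))))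
    \<le> (1 + exp (- 2 * m * card (active n K F))) / 2
       * (\<Sum>v\<in>carrier_vec r. exp (- m * (\<Sum>i\<in>{..<n} - active n K F. gap (\<rho> i) (scalar_prod v (F i)))))"
    (is "(\<Sum>v\<in>?G. ?f v) \<le> ?h * (\<Sum>v\<in>?G. ?out v)")
proof -
  let ?I = "active n K F"
  let ?in = "\<lambda>v. exp (- m * (\<Sum>i\<in>?I. gap (\<rho> i) (scalar_prod v (F i))))"
  have I: "?I \<subseteq> {..<n}" "finite ?I" by (auto simp: active_def)
  have KG: "K \<subseteq> ?G" using K by (simp add: vec_subgrp_def)
  have Kne: "card K > 0" using K finite_subgrp[OF K] by (auto simp: vec_subgrp_def card_gt_0_iff)
  have split: "?f v = ?out v * ?in v" for v
    using I by (simp add: sum.subset_diff[of ?I "{..<n}"] ring_distribs flip: exp_add)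
  have out: "?out (u + v) = ?out v" if "u \<in> K" "v \<in> ?G" for u v
  proof -
    have "scalar_prod (u + v) (F i) = scalar_prod v (F i)" if "i \<in> {..<n} - ?I" for i
    proof -
      have "scalar_prod u (F i) = 0" using that \<open>u \<in> K\<close> by (auto simp: active_def)
      moreover have "scalar_prod (u + v) (F i) = scalar_prod u (F i) + scalar_prod v (F i)"
        using that \<open>u \<in> K\<close> \<open>v \<in> ?G\<close> KG F by (intro add_scalar_prod_distrib) auto
      ultimately show ?thesis by simp
    qed
    then show ?thesis by simp
  qed
  \<comment> \<open>Each \<open>u\<close> in \<open>K\<close> merely permutes the frequencies, so the sum may be replaced by its average over these translations.\<close>
  have "card K * (\<Sum>v\<in>?G. ?f v) = (\<Sum>u\<in>K. \<Sum>v\<in>?G. ?f v)" by simp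
  also have "\<dots> = (\<Sum>u\<in>K. \<Sum>v\<in>?G. ?f (u + v))"
  proof (rule sum.cong[OF refl])
    fix u assume "u \<in> K"
    then have u: "u \<in> ?G" using KG by auto
    have img: "(\<lambda>v. v + u) ` ?G = ?G" by (rule subgrp_translate[OF subgrp_carrier u])
    then have inj: "inj_on (\<lambda>v. v + u) ?G" by (metis eq_card_imp_inj_on finite_carrier_vec)
    have "(\<Sum>v\<in>?G. ?f v) = (\<Sum>v\<in>(\<lambda>v. v + u) ` ?G. ?f v)" using img by simp
    also have "\<dots> = (\<Sum>v\<in>?G. ?f (v + u))" using inj by (simp add: sum.reindex)
    also have "\<dots> = (\<Sum>v\<in>?G. ?f (u + v))"
    proof (rule sum.cong[OF refl])
      fix v assume "v \<in> ?G"
      then have "v + u = u + v" using u by (intro comm_add_vec) auto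
      then show "?f (v + u) = ?f (u + v)" by simp
    qed
    finally show "(\<Sum>v\<in>?G. ?f v) = (\<Sum>v\<in>?G. ?f (u + v))" .
  qed
  also have "\<dots> = (\<Sum>v\<in>?G. \<Sum>u\<in>K. ?f (u + v))" by (rule sum.swap)
  also have "\<dots> = (\<Sum>v\<in>?G. \<Sum>u\<in>K. ?out v * ?in (u + v))"
    by (intro sum.cong refl) (simp only: split out)
  also have "\<dots> = (\<Sum>v\<in>?G. ?out v * (\<Sum>u\<in>K. ?in (u + v)))"
    by (simp only: sum_distrib_left)
  also have "\<dots> \<le> (\<Sum>v\<in>?G. ?out v * (card K * ?h))"
  proof (intro sum_mono mult_left_mono)
    fix v assume v: "v \<in> ?G"
    show "(\<Sum>u\<in>K. ?in (u + v)) \<le> card K * ?h"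
      using I F \<rho> v by (intro sum_exp_translate_le[OF K]) (auto simp: active_def)
  qed auto
  also have "\<dots> = card K * (?h * (\<Sum>v\<in>?G. ?out v))" by (subst sum_distrib_right[symmetric]) (simp only: mult_ac)
  finally show ?thesis using Kne by simp
qed

text \<open>
  Take a family \<open>T\<close> of vectors as large as possible among those whose joint support has at most
  \<open>card T * s\<close> elements. Every vector supported inside the joint support could be added to \<open>T\<close> for free, so \<open>T\<close> is a
  subgroup; and a vector with fewer than \<open>s\<close> new support elements could be added as well, so all remaining vectors have
  weight at least \<open>s\<close> off the joint support. This avoids any choice of bases or dimensions.
\<close>

lemma ex_degenerate_subgroup:
  fixes s :: real
  assumes F: "\<And>i. i < n \<Longrightarrow> F i \<in> (carrier_vec r :: 'p::prime_card mod_ring Matrix.vec set)" and s: "0 \<le> s"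
  shows "\<exists>K. vec_subgrp r K \<and> real (card (active n K F)) \<le> CARD('p) ^ r * s \<and>
    (\<forall>v\<in>carrier_vec r - K. s \<le> card {i \<in> {..<n} - active n K F. scalar_prod v (F i) \<noteq> 0})"
proof -
  let ?G = "carrier_vec r :: 'p mod_ring Matrix.vec set"
  let ?P = "\<lambda>T. T \<subseteq> ?G \<and> real (card (active n T F)) \<le> card T * s"
  have "?P {}" by (simp add: active_def)
  moreover have "\<forall>T. ?P T \<longrightarrow> card T < Suc (card ?G)" using card_mono[of ?G] by (simp add: less_Suc_eq_le)
  ultimately obtain T where T: "?P T" and Tmax: "\<And>U. ?P U \<Longrightarrow> card U \<le> card T"
    using Lattices_Big.ex_has_greatest_nat[of ?P "{}" card "Suc (card ?G)"] by blast
  let ?I = "active n T F"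
  define K where "K = {v \<in> ?G. \<forall>i<n. i \<notin> ?I \<longrightarrow> scalar_prod v (F i) = 0}"
  have TK: "T \<subseteq> K" using T by (auto simp: K_def active_def)
  have finI: "finite ?I" by (simp add: active_def)
  have finK: "finite K" by (rule finite_subset[of _ ?G]) (auto simp: K_def)
  have act: "active n K F = ?I"
  proof
    show "active n K F \<subseteq> ?I" by (auto simp: active_def K_def)
    show "?I \<subseteq> active n K F" using TK by (auto simp: active_def)
  qed
  have "real (card ?I) \<le> card K * s"
    using T card_mono[OF finK TK] s by (meson mult_right_mono of_nat_mono order_trans)
  then have "card K \<le> card T" using act by (intro Tmax) (auto simp: K_def)
  then have KT: "T = K" using TK finK by (simp add: card_seteq)
  have "vec_subgrp r K"
  proof -
    have "scalar_prod (u + v) (F i) = scalar_prod u (F i) + scalar_prod v (F i)"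
      if "u \<in> ?G" "v \<in> ?G" "i < n" for u v i
      using that F by (intro add_scalar_prod_distrib) auto
    then show ?thesis using F by (auto simp: vec_subgrp_def K_def)
  qed
  moreover have "real (card (active n K F)) \<le> CARD('p) ^ r * s"
  proof -
    have "card T \<le> CARD('p) ^ r" using T card_mono[of ?G T] by (simp add: card_vec)
    then have "card T * s \<le> real (CARD('p) ^ r) * s" using s by (intro mult_right_mono) (simp only: of_nat_le_iff)
    then show ?thesis using T act by simp
  qed
  moreover have "s \<le> card {i \<in> {..<n} - active n K F. scalar_prod v (F i) \<noteq> 0}" if v: "v \<in> ?G - K" for v
  proof (rule ccontr)
    let ?N = "{i \<in> {..<n} - ?I. scalar_prod v (F i) \<noteq> 0}"
    assume "\<not> s \<le> card {i \<in> {..<n} - active n K F. scalar_prod v (F i) \<noteq> 0}"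
    then have less: "card ?N < s" by (simp add: act)
    have vT: "v \<notin> T" using v KT by simp
    have finT: "finite T" using T finite_subset by (metis finite_carrier_vec)
    have "active n (insert v T) F \<subseteq> ?I \<union> ?N" by (auto simp: active_def)
    then have "card (active n (insert v T) F) \<le> card (?I \<union> ?N)"
      using finI by (intro card_mono) auto
    also have "\<dots> \<le> card ?I + card ?N" by (rule card_Un_le)
    finally have "real (card (active n (insert v T) F)) \<le> real (card ?I) + real (card ?N)" by simp
    also have "\<dots> \<le> card T * s + s" using T less by simp
    also have "\<dots> = card (insert v T) * s" using vT finT by (simp add: ring_distribs)
    finally have "card (insert v T) \<le> card T" using v T by (intro Tmax) auto
    then show False using vT finT by simp
  qed
  ultimately show ?thesis by blast
qed

lemma exp_minus_le: fixes x :: real assumes "0 \<le> x" shows "exp (- x) \<le> 1 - x + x\<^sup>2 / 2"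
proof -
  have "(1 - x + x\<^sup>2 / 2) * (1 + x + x\<^sup>2 / 2) = 1 + (x\<^sup>2)\<^sup>2 / 4"
    by (simp add: power2_eq_square algebra_simps)
  then have "1 \<le> (1 - x + x\<^sup>2 / 2) * (1 + x + x\<^sup>2 / 2)" by simp
  also have "\<dots> \<le> (1 - x + x\<^sup>2 / 2) * exp x"
  proof (rule mult_left_mono)
    show "1 + x + x\<^sup>2 / 2 \<le> exp x" using assms by (rule exp_lower_Taylor_quadratic)
    show "0 \<le> 1 - x + x\<^sup>2 / 2"
      using zero_le_power2[of "x - 1"] by (simp add: power2_eq_square algebra_simps)
  qed
  finally show ?thesis by (simp add: exp_minus field_simps)
qed

text \<open>
  The Chernoff bound for columns chosen independently and uniformly, those outside \<open>I\<close> from the annihilator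
  of \<open>K\<close>: by \<open>sum_gap_annih\<close> the gaps have mean 1, and their values in \<open>[0, 2]\<close> give \<open>gap\<^sup>2 \<le> 2 * gap\<close>.
  The loss of up to \<open>\<epsilon> / 2 * n\<close> columns in \<open>I\<close> uses up half of the permitted deviation.
\<close>

lemma card_gap_sum_small:
  fixes K :: "'p::prime_card mod_ring Matrix.vec set" and n :: nat and \<epsilon> :: real
  assumes K: "vec_subgrp r K" and \<rho>: "\<And>i. i < n \<Longrightarrow> step_dist (\<rho> i)"
    and v: "v \<in> carrier_vec r" "v \<notin> K" and \<epsilon>: "0 < \<epsilon>" "\<epsilon> < 1"
    and I: "I \<subseteq> {..<n}" "real (card I) \<le> \<epsilon> / 2 * n"
  defines "B \<equiv> \<lambda>i. if i \<in> I then carrier_vec r else annih r K"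
  shows "real (card {F \<in> PiE {..<n} B. (\<Sum>i\<in>{..<n} - I. gap (\<rho> i) (scalar_prod v (F i))) < (1 - \<epsilon>) * n})
    \<le> exp (- \<epsilon>\<^sup>2 / 16 * n) * card (PiE {..<n} B)"
proof -
  \<comment> \<open>This value minimises \<open>- l * \<epsilon> / 2 + l\<^sup>2\<close>, the exponent per column.\<close>
  define l where "l = \<epsilon> / 4"
  have l: "0 < l" "l < 1" using \<epsilon> by (auto simp: l_def)
  \<comment> \<open>Columns in \<open>I\<close> are not counted and get the trivial weight.\<close>
  define g where "g i y = (if i \<in> I then 1 else exp (- l * gap (\<rho> i) (scalar_prod v y)))" for i y
  let ?P = "PiE {..<n} B"
  let ?S = "\<lambda>F. \<Sum>i\<in>{..<n} - I. gap (\<rho> i) (scalar_prod v (F i))"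
  let ?bad = "{F \<in> ?P. ?S F < (1 - \<epsilon>) * n}"
  have finB: "finite (B i)" for i using finite_subgrp[OF subgrp_annih[OF K]] by (simp add: B_def)
  have finP: "finite ?P" by (intro finite_PiE finB) auto
  have prod: "(\<Prod>i<n. g i (F i)) = exp (- l * ?S F)" for F
  proof -
    have "(\<Prod>i<n. g i (F i)) = (\<Prod>i\<in>{..<n} - I. g i (F i))"
      using I by (intro prod.mono_neutral_right) (auto simp: g_def)
    also have "\<dots> = exp (\<Sum>i\<in>{..<n} - I. - l * gap (\<rho> i) (scalar_prod v (F i)))"
      by (simp add: exp_sum g_def)
    finally show ?thesis by (simp add: sum_distrib_left sum_negf)
  qed
  have one: "(\<Sum>y\<in>B i. g i y) \<le> card (B i) * (if i \<in> I then 1 else exp (- l + l\<^sup>2))" if i: "i < n" for i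
  proof (cases "i \<in> I")
    case True then show ?thesis by (simp add: g_def)
  next
    case False
    have "g i y \<le> 1 - (l - l\<^sup>2) * gap (\<rho> i) (scalar_prod v y)" for y
    proof -
      let ?x = "gap (\<rho> i) (scalar_prod v y)"
      have x: "0 \<le> ?x" "?x \<le> 2" using gap_nonneg gap_le_2 \<rho> i by blast+
      have "exp (- (l * ?x)) \<le> 1 - l * ?x + (l * ?x)\<^sup>2 / 2" using x l by (intro exp_minus_le) auto
      also have "(l * ?x)\<^sup>2 / 2 = l\<^sup>2 * (?x * ?x) / 2" by (simp add: power2_eq_square)
      also have "\<dots> \<le> l\<^sup>2 * (?x * 2) / 2" using x by (intro divide_right_mono mult_left_mono) auto
      finally show ?thesis using False by (simp add: g_def algebra_simps)
    qed
    then have "(\<Sum>y\<in>B i. g i y) \<le> (\<Sum>y\<in>B i. 1 - (l - l\<^sup>2) * gap (\<rho> i) (scalar_prod v y))"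
      by (intro sum_mono)
    also have "\<dots> = card (B i) * (1 - l + l\<^sup>2)"
      using sum_gap_annih[OF K \<rho>[OF i] v] False
      by (simp add: sum_subtractf B_def algebra_simps flip: sum_distrib_left sum_distrib_right)
    also have "\<dots> \<le> card (B i) * exp (- l + l\<^sup>2)"
      using exp_ge_add_one_self[of "- l + l\<^sup>2"] by (intro mult_left_mono) (linarith, simp)
    finally show ?thesis using False by simp
  qed
  have "card ?bad * exp (- (l * ((1 - \<epsilon>) * n))) = (\<Sum>F\<in>?bad. exp (- (l * ((1 - \<epsilon>) * n))))" by simp
  also have "\<dots> \<le> (\<Sum>F\<in>?bad. \<Prod>i<n. g i (F i))"
    unfolding prod using l by (intro sum_mono) auto
  also have "\<dots> \<le> (\<Sum>F\<in>?P. \<Prod>i<n. g i (F i))"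
    using finP by (intro sum_mono2) (auto simp: prod)
  also have "\<dots> = (\<Prod>i<n. \<Sum>y\<in>B i. g i y)"
    by (rule prod_sum_PiE[symmetric]) (auto simp: finB)
  also have "\<dots> \<le> (\<Prod>i<n. card (B i) * (if i \<in> I then 1 else exp (- l + l\<^sup>2)))"
    by (intro prod_mono conjI one sum_nonneg) (auto simp: g_def)
  also have "\<dots> = card ?P * (\<Prod>i<n. if i \<in> I then 1 else exp (- l + l\<^sup>2))"
    by (simp add: card_PiE prod.distrib)
  also have "(\<Prod>i<n. if i \<in> I then 1 else exp (- l + l\<^sup>2)) = (\<Prod>i\<in>{..<n} - I. exp (- l + l\<^sup>2))"
    by (rule prod.mono_neutral_cong_right) auto
  also have "\<dots> = exp ((- l + l\<^sup>2) * (real n - card I))"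
  proof -
    have "card ({..<n} - I) = n - card I" "card I \<le> n"
      using I finite_subset[OF I(1)] card_mono[OF _ I(1)] by (auto simp: card_Diff_subset)
    then show ?thesis by (simp add: of_nat_diff flip: exp_of_nat_mult)
  qed
  finally have "card ?bad * exp (- (l * ((1 - \<epsilon>) * n))) \<le> card ?P * exp ((- l + l\<^sup>2) * (real n - card I))" .
  have move: "c \<le> R * exp a" if "c * exp (- a) \<le> R" for a c R :: real
    using that by (simp add: exp_minus field_simps)
  have "card ?bad \<le> card ?P * exp ((- l + l\<^sup>2) * (real n - card I)) * exp (l * ((1 - \<epsilon>) * n))"
    by (rule move) fact
  also have "\<dots> = card ?P * (exp ((- l + l\<^sup>2) * (real n - card I)) * exp (l * ((1 - \<epsilon>) * n)))"
    by (rule mult.assoc)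
  also have "\<dots> \<le> card ?P * exp (- \<epsilon>\<^sup>2 / 16 * n)"
  proof (rule mult_left_mono)
    have "(l - l\<^sup>2) * ((1 - \<epsilon> / 2) * n) \<le> (l - l\<^sup>2) * (real n - card I)"
      using l I(2) by (intro mult_left_mono) (auto simp: power2_eq_square algebra_simps)
    moreover have "(- l + l\<^sup>2) * (real n - card I) = - ((l - l\<^sup>2) * (real n - card I))"
      by (simp add: algebra_simps)
    ultimately have "(- l + l\<^sup>2) * (real n - card I) + l * ((1 - \<epsilon>) * n) \<le> - (l - l\<^sup>2) * ((1 - \<epsilon> / 2) * n) + l * ((1 - \<epsilon>) * n)"
      by linarith
    also have "\<dots> = (- \<epsilon>\<^sup>2 / 16 - l * l * \<epsilon> / 2) * n"
      by (simp add: l_def power2_eq_square field_simps)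
    also have "\<dots> \<le> - \<epsilon>\<^sup>2 / 16 * n" using l \<epsilon> by (intro mult_right_mono) auto
    finally show "exp ((- l + l\<^sup>2) * (real n - card I)) * exp (l * ((1 - \<epsilon>) * n)) \<le> exp (- \<epsilon>\<^sup>2 / 16 * n)"
      by (simp flip: exp_add)
  qed simp
  finally show ?thesis by (simp add: mult.commute)
qed

section \<open>Summing over matrices of full rank\<close>

lemma sum_UN_le:
  fixes f :: "'a \<Rightarrow> real"
  assumes "finite J" "\<And>x. x \<in> J \<Longrightarrow> finite (S x)" "\<And>y. 0 \<le> f y"
  shows "(\<Sum>y\<in>(\<Union>x\<in>J. S x). f y) \<le> (\<Sum>x\<in>J. \<Sum>y\<in>S x. f y)"
  using assms
proof (induction J rule: finite_induct)
  case (insert x J)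
  have "(\<Sum>y\<in>S x \<union> (\<Union>x\<in>J. S x). f y) \<le> (\<Sum>y\<in>S x. f y) + (\<Sum>y\<in>(\<Union>x\<in>J. S x). f y)"
    using insert sum_nonneg[of "S x \<inter> (\<Union>x\<in>J. S x)" f] sum.union_inter[of "S x" "\<Union>x\<in>J. S x" f] by simp
  then show ?case using insert by simp
qed simp

text \<open>
  An upper bound for the probability that \<open>F\<close> maps one random column to 0, obtained from Fourier
  inversion by the triangle inequality.
\<close>

definition fourier_bound :: "nat \<Rightarrow> nat \<Rightarrow> real \<Rightarrow> (nat \<Rightarrow> 'p::prime_card mod_ring \<Rightarrow> real)
    \<Rightarrow> (nat \<Rightarrow> 'p mod_ring Matrix.vec) \<Rightarrow> real" where
  "fourier_bound r n m \<rho> F =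
    (\<Sum>v\<in>carrier_vec r. exp (- m * (\<Sum>i<n. gap (\<rho> i) (scalar_prod v (F i))))) / real (CARD('p) ^ r)"

text \<open>
  With \<open>t = \<kappa> * s\<close>, the first term accounts for the typical \<open>F\<close>, whose gaps sum to at least \<open>(1 - \<epsilon>) * n\<close>. The second
  bounds the contribution of the exceptional \<open>F\<close>: the factor in front of the power bounds their proportion, and the power uses only that
  each gap sum is at least \<open>t\<close>.
\<close>

definition main_factor :: "real \<Rightarrow> nat \<Rightarrow> real \<Rightarrow> real \<Rightarrow> real \<Rightarrow> real" where
  "main_factor L n m \<epsilon> t = (1 + L * exp (- m * ((1 - \<epsilon>) * n))) ^ n
     + n * L * exp (- \<epsilon>\<^sup>2 / 16 * n) * (1 + L * exp (- m * t)) ^ n"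

lemma sum_exp_subgroup_le:
  fixes K :: "'p::prime_card mod_ring Matrix.vec set" and m e :: real
  assumes K: "vec_subgrp r K" and e: "\<And>v. v \<in> carrier_vec r - K \<Longrightarrow>
      exp (- m * (\<Sum>i\<in>{..<n} - active n K F. gap (\<rho> i) (scalar_prod v (F i)))) \<le> e" and e0: "0 \<le> e"
  shows "(\<Sum>v\<in>carrier_vec r. exp (- m * (\<Sum>i\<in>{..<n} - active n K F. gap (\<rho> i) (scalar_prod v (F i)))))
     \<le> card K * (1 + real (CARD('p) ^ r) * e)"
proof -
  let ?G = "carrier_vec r :: 'p mod_ring Matrix.vec set"
  let ?out = "\<lambda>v. exp (- m * (\<Sum>i\<in>{..<n} - active n K F. gap (\<rho> i) (scalar_prod v (F i))))"
  have KG: "K \<subseteq> ?G" using K by (simp add: vec_subgrp_def)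
  have K1: "1 \<le> card K" using K finite_subgrp[OF K] by (auto simp: vec_subgrp_def card_gt_0_iff Suc_le_eq)
  have "(\<Sum>v\<in>?G. ?out v) = (\<Sum>v\<in>?G - K. ?out v) + (\<Sum>v\<in>K. ?out v)"
    by (rule sum.subset_diff[OF KG finite_carrier_vec])
  also have "(\<Sum>v\<in>K. ?out v) = (\<Sum>v\<in>K. 1)"
    by (intro sum.cong refl) (auto simp: active_def)
  also have "(\<Sum>v\<in>?G - K. ?out v) \<le> card (?G - K) * e"
    using e by (intro sum_bounded_above) blast
  also have "\<dots> \<le> real (CARD('p) ^ r) * e"
  proof (intro mult_right_mono e0)
    have "card (?G - K) \<le> CARD('p) ^ r" unfolding card_vec[symmetric] by (intro card_mono) auto
    then show "real (card (?G - K)) \<le> real (CARD('p) ^ r)" by (simp only: of_nat_le_iff)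
  qed
  also have "\<dots> \<le> card K * (real (CARD('p) ^ r) * e)"
    using mult_right_mono[of 1 "real (card K)" "real (CARD('p) ^ r) * e"] K1 e0 by simp
  finally show ?thesis by (simp add: algebra_simps)
qed

text \<open>
  The union bound over the columns \<open>j\<close> of the random matrix and the frequencies \<open>v\<close>.
\<close>

lemma card_ex_gap_sum_small:
  fixes K :: "'p::prime_card mod_ring Matrix.vec set" and n :: nat and \<epsilon> :: real
  assumes K: "vec_subgrp r K" and \<rho>: "\<And>i j. i < n \<Longrightarrow> j < n \<Longrightarrow> step_dist (\<rho> j i)"
    and \<epsilon>: "0 < \<epsilon>" "\<epsilon> < 1" and I: "I \<subseteq> {..<n}" "real (card I) \<le> \<epsilon> / 2 * n"
  shows "real (card (\<Union>j<n. \<Union>v\<in>carrier_vec r - K.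
      {F \<in> PiE {..<n} (\<lambda>i. if i \<in> I then carrier_vec r else annih r K).
        (\<Sum>i\<in>{..<n} - I. gap (\<rho> j i) (scalar_prod v (F i))) < (1 - \<epsilon>) * n}))
    \<le> n * real (CARD('p) ^ r) * exp (- \<epsilon>\<^sup>2 / 16 * n)
      * card (PiE {..<n} (\<lambda>i. if i \<in> I then carrier_vec r else annih r K))"
proof -
  let ?G = "carrier_vec r :: 'p mod_ring Matrix.vec set" and ?L = "real (CARD('p) ^ r)"
  let ?P = "PiE {..<n} (\<lambda>i. if i \<in> I then carrier_vec r else annih r K)"
  let ?low = "\<lambda>j v. {F \<in> ?P. (\<Sum>i\<in>{..<n} - I. gap (\<rho> j i) (scalar_prod v (F i))) < (1 - \<epsilon>) * n}"
  let ?\<tau> = "exp (- \<epsilon>\<^sup>2 / 16 * n)"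
  have "card (\<Union>j<n. \<Union>v\<in>?G - K. ?low j v) \<le> (\<Sum>j<n. card (\<Union>v\<in>?G - K. ?low j v))"
    by (rule card_UN_le) simp
  also have "\<dots> \<le> (\<Sum>j<n. \<Sum>v\<in>?G - K. card (?low j v))"
    by (intro sum_mono card_UN_le) simp
  finally have "real (card (\<Union>j<n. \<Union>v\<in>?G - K. ?low j v)) \<le> real (\<Sum>j<n. \<Sum>v\<in>?G - K. card (?low j v))"
    by (simp only: of_nat_le_iff)
  also have "\<dots> = (\<Sum>j<n. \<Sum>v\<in>?G - K. real (card (?low j v)))" by (simp only: of_nat_sum)
  also have "\<dots> \<le> (\<Sum>j<n. \<Sum>v\<in>?G - K. ?\<tau> * card ?P)"
  proof (intro sum_mono)
    fix j v assume "j \<in> {..<n}" "v \<in> ?G - K"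
    then show "real (card (?low j v)) \<le> ?\<tau> * card ?P"
      using card_gap_sum_small[OF K, where n=n and \<rho>="\<rho> j" and v=v and \<epsilon>=\<epsilon> and I=I] \<rho> \<epsilon> I by simp
  qed
  also have "\<dots> = n * (card (?G - K) * (?\<tau> * card ?P))" by simp
  also have "\<dots> \<le> n * (?L * (?\<tau> * card ?P))"
  proof (intro mult_left_mono mult_right_mono)
    have "card (?G - K) \<le> CARD('p) ^ r" unfolding card_vec[symmetric] by (intro card_mono) auto
    then show "real (card (?G - K)) \<le> ?L" by (simp only: of_nat_le_iff)
  qed auto
  finally show ?thesis by (simp add: mult_ac)
qed

text \<open>
  The matrices with a prescribed degenerate subgroup \<open>K\<close> and support \<open>I\<close>. Such an \<open>F\<close> has its columns off \<open>I\<close> in the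
  annihilator of \<open>K\<close>, which has \<open>L / card K\<close> elements, while each of the \<open>n\<close> probabilities is about \<open>card K / L\<close> times
  \<open>(1 + exp (- 2 * m * card I)) / 2\<close>. The powers of \<open>card K / L\<close> cancel; only the \<open>card I\<close> unrestricted columns leave a surplus, of at most \<open>L\<close> each.
\<close>

lemma sum_stratum_le:
  fixes K :: "'p::prime_card mod_ring Matrix.vec set" and n :: nat and L \<epsilon> m s \<kappa> :: real
  assumes K: "vec_subgrp r K" and \<rho>: "\<And>i j. i < n \<Longrightarrow> j < n \<Longrightarrow> step_dist (\<rho> j i)"
    and \<epsilon>: "0 < \<epsilon>" "\<epsilon> < 1" and m: "0 \<le> m" and I: "I \<subseteq> {..<n}" "real (card I) \<le> \<epsilon> / 2 * n"
    and \<kappa>: "0 < \<kappa>" "\<And>x :: 'p mod_ring. x \<noteq> 0 \<Longrightarrow> \<kappa> \<le> 1 - Re (add_char x)"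
  defines "\<Omega> \<equiv> {F \<in> {..<n} \<rightarrow>\<^sub>E carrier_vec r. active n K F = I \<and>
      (\<forall>v\<in>carrier_vec r - K. s \<le> card {i \<in> {..<n} - I. scalar_prod v (F i) \<noteq> 0})}"
    and "L \<equiv> real (CARD('p) ^ r)"
  shows "(\<Sum>F\<in>\<Omega>. \<Prod>j<n. fourier_bound r n m (\<rho> j) F)
     \<le> ((1 + exp (- 2 * m * card I)) / 2) ^ n * L ^ card I * main_factor L n m \<epsilon> (\<kappa> * s)"
proof -
  let ?G = "carrier_vec r :: 'p mod_ring Matrix.vec set"
  define B where "B i = (if i \<in> I then ?G else annih r K)" for i
  let ?P = "PiE {..<n} B"
  let ?S = "\<lambda>j v F. \<Sum>i\<in>{..<n} - I. gap (\<rho> j i) (scalar_prod v (F i))"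
  let ?low = "\<lambda>j v. {F \<in> ?P. ?S j v F < (1 - \<epsilon>) * n}"
  define bad where "bad = (\<Union>j<n. \<Union>v\<in>?G - K. ?low j v)"
  let ?\<tau> = "exp (- \<epsilon>\<^sup>2 / 16 * n)"
  let ?h = "(1 + exp (- 2 * m * card I)) / 2"
  let ?E2 = "L * exp (- m * ((1 - \<epsilon>) * n))" and ?E1 = "L * exp (- m * (\<kappa> * s))"
  have finB: "finite (B i)" for i using finite_subgrp[OF subgrp_annih[OF K]] by (simp add: B_def)
  have finP: "finite ?P" by (intro finite_PiE finB) auto
  have L: "0 < L" by (simp add: L_def)
  have finI: "finite I" using I(1) finite_subset by blast
  have badP: "bad \<subseteq> ?P" by (auto simp: bad_def)
  have \<Omega>P: "\<Omega> \<subseteq> ?P"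
  proof
    fix F assume F: "F \<in> \<Omega>"
    have "F i \<in> B i" if "i < n" for i
    proof (cases "i \<in> I")
      case True then show ?thesis using F that by (auto simp: B_def \<Omega>_def)
    next
      case False
      then have "i \<notin> active n K F" using F by (simp add: \<Omega>_def)
      then show ?thesis using F that False by (auto simp: B_def \<Omega>_def annih_def active_def)
    qed
    then show "F \<in> ?P" using F by (auto simp: \<Omega>_def PiE_iff)
  qed
  have pt: "(\<Prod>j<n. fourier_bound r n m (\<rho> j) F) \<le> (card K / L * ?h) ^ n * (1 + E) ^ n"
    if F: "F \<in> \<Omega>" and E: "E = L * e" "0 \<le> e" and e: "\<And>j v. j < n \<Longrightarrow> v \<in> ?G - K \<Longrightarrow> exp (- m * ?S j v F) \<le> e" for F E e
  proof -
    have act: "active n K F = I" and FG: "\<And>i. i < n \<Longrightarrow> F i \<in> ?G" using F by (auto simp: \<Omega>_def)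
    have "fourier_bound r n m (\<rho> j) F \<le> card K / L * ?h * (1 + E)" if j: "j < n" for j
    proof -
      have "(\<Sum>v\<in>?G. exp (- m * (\<Sum>i<n. gap (\<rho> j i) (scalar_prod v (F i))))) \<le> ?h * (\<Sum>v\<in>?G. exp (- m * ?S j v F))"
        using sum_exp_gap_le[OF K, where n=n and \<rho>="\<rho> j" and F=F and m=m] \<rho> j FG by (simp add: act)
      also have "\<dots> \<le> ?h * (card K * (1 + L * e))"
        using sum_exp_subgroup_le[OF K, where m=m and n=n and F=F and \<rho>="\<rho> j" and e=e] e[OF j] E
        by (intro mult_left_mono) (auto simp: act L_def intro: add_nonneg_nonneg)
      finally show ?thesis using L E unfolding fourier_bound_def L_def[symmetric] by (simp add: field_simps)
    qed
    then have "(\<Prod>j<n. fourier_bound r n m (\<rho> j) F) \<le> (\<Prod>j<n. card K / L * ?h * (1 + E))"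
      by (intro prod_mono) (auto simp: fourier_bound_def intro!: divide_nonneg_nonneg sum_nonneg)
    then show ?thesis by (simp only: prod_constant card_lessThan power_mult_distrib)
  qed
  have each: "(\<Prod>j<n. fourier_bound r n m (\<rho> j) F)
      \<le> (card K / L * ?h) ^ n * ((1 + ?E2) ^ n + (if F \<in> bad then (1 + ?E1) ^ n else 0))" if F: "F \<in> \<Omega>" for F
  proof (cases "F \<in> bad")
    case True
    have "(\<Prod>j<n. fourier_bound r n m (\<rho> j) F) \<le> (card K / L * ?h) ^ n * (1 + ?E1) ^ n"
    proof (rule pt[OF F refl])
      fix j v assume j: "j < n" and v: "v \<in> ?G - K"
      let ?N = "{i \<in> {..<n} - I. scalar_prod v (F i) \<noteq> 0}"
      have "\<kappa> * s \<le> \<kappa> * card ?N" using F v \<kappa>(1) by (auto simp: \<Omega>_def)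
      also have "\<dots> = (\<Sum>i\<in>?N. \<kappa>)" by simp
      also have "\<dots> \<le> (\<Sum>i\<in>?N. gap (\<rho> j i) (scalar_prod v (F i)))"
        using \<rho> j \<kappa> by (intro sum_mono gap_ge) auto
      also have "\<dots> \<le> ?S j v F" using \<rho> j by (intro sum_mono2) (auto intro: gap_nonneg)
      finally show "exp (- m * ?S j v F) \<le> exp (- m * (\<kappa> * s))" using m by (simp add: mult_left_mono)
    qed simp
    also have "\<dots> \<le> (card K / L * ?h) ^ n * ((1 + ?E2) ^ n + (1 + ?E1) ^ n)"
      using L by (intro mult_left_mono zero_le_power mult_nonneg_nonneg) (auto intro!: add_nonneg_nonneg zero_le_power)
    finally show ?thesis using True by simp
  next
    case False
    have "(\<Prod>j<n. fourier_bound r n m (\<rho> j) F) \<le> (card K / L * ?h) ^ n * (1 + ?E2) ^ n"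
    proof (rule pt[OF F refl])
      fix j v assume j: "j < n" and v: "v \<in> ?G - K"
      have "(1 - \<epsilon>) * n \<le> ?S j v F" using False \<Omega>P F j v by (force simp: bad_def)
      then show "exp (- m * ?S j v F) \<le> exp (- m * ((1 - \<epsilon>) * n))" using m by (simp add: mult_left_mono)
    qed simp
    then show ?thesis using False by simp
  qed
  have card_bad: "card bad \<le> n * L * ?\<tau> * card ?P"
    unfolding bad_def L_def B_def using \<rho> by (intro card_ex_gap_sum_small K \<epsilon> I)
  have K1: "1 \<le> card K" using K finite_subgrp[OF K] by (auto simp: vec_subgrp_def card_gt_0_iff Suc_le_eq)
  have cann: "real (card (annih r K)) = L / card K"
    using arg_cong[OF card_annih[OF K], of real] K1 unfolding L_def by (simp add: field_simps)
  have cKL: "real (card K) \<le> L"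
  proof -
    have "card K \<le> CARD('p) ^ r" unfolding card_vec[symmetric] using K by (intro card_mono) (auto simp: vec_subgrp_def)
    then show ?thesis unfolding L_def by (simp only: of_nat_le_iff)
  qed
  have cardP: "(card K / L) ^ n * card ?P \<le> L ^ card I"
  proof -
    have "(card K / L) ^ n * card ?P = (\<Prod>i<n. card K / L * card (B i))"
      by (simp only: card_PiE finite_lessThan prod.distrib prod_constant card_lessThan of_nat_prod)
    also have "\<dots> = (\<Prod>i<n. if i \<in> I then real (card K) else 1)"
      using L K1 by (intro prod.cong refl) (auto simp: B_def cann card_vec L_def)
    also have "\<dots> = (\<Prod>i\<in>I. real (card K))"
      using I by (intro prod.mono_neutral_cong_right) auto
    also have "\<dots> \<le> L ^ card I" using cKL by (simp add: power_mono)
    finally show ?thesis .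
  qed
  have "(\<Sum>F\<in>\<Omega>. \<Prod>j<n. fourier_bound r n m (\<rho> j) F)
    \<le> (\<Sum>F\<in>\<Omega>. (card K / L * ?h) ^ n * ((1 + ?E2) ^ n + (if F \<in> bad then (1 + ?E1) ^ n else 0)))"
    by (rule sum_mono) (rule each)
  also have "\<dots> \<le> (\<Sum>F\<in>?P. (card K / L * ?h) ^ n * ((1 + ?E2) ^ n + (if F \<in> bad then (1 + ?E1) ^ n else 0)))"
    using L by (intro sum_mono2 finP \<Omega>P mult_nonneg_nonneg zero_le_power add_nonneg_nonneg) auto
  also have "\<dots> = (card K / L * ?h) ^ n * (card ?P * (1 + ?E2) ^ n + card bad * (1 + ?E1) ^ n)"
    using badP finP by (simp add: sum.distrib sum.If_cases Int_absorb1 flip: sum_distrib_left)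
  also have "\<dots> \<le> (card K / L * ?h) ^ n * (card ?P * (1 + ?E2) ^ n + n * L * ?\<tau> * card ?P * (1 + ?E1) ^ n)"
    using L card_bad by (intro mult_left_mono add_left_mono mult_right_mono zero_le_power) auto
  also have "\<dots> = ?h ^ n * ((card K / L) ^ n * card ?P) * main_factor L n m \<epsilon> (\<kappa> * s)"
    unfolding main_factor_def power_mult_distrib by (simp only: ring_distribs mult_ac)
  also have "\<dots> \<le> ?h ^ n * L ^ card I * main_factor L n m \<epsilon> (\<kappa> * s)"
    using L cardP by (intro mult_right_mono mult_left_mono zero_le_power)
      (auto simp: main_factor_def intro!: add_nonneg_nonneg mult_nonneg_nonneg)
  finally show ?thesis .
qed

text \<open>
  Full rank is expressed by the rows: no nontrivial combination of them vanishes.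
\<close>

definition full_rank :: "nat \<Rightarrow> nat \<Rightarrow> (nat \<Rightarrow> 'p::prime_card mod_ring Matrix.vec) set" where
  "full_rank r n = {F \<in> {..<n} \<rightarrow>\<^sub>E carrier_vec r. \<forall>v\<in>carrier_vec r - {0\<^sub>v r}. \<exists>i<n. scalar_prod v (F i) \<noteq> 0}"

text \<open>
  Every full rank matrix belongs to the stratum of its degenerate subgroup. The stratum with empty \<open>I\<close> carries
  the main term 1; there are at most \<open>2 ^ L\<close> subgroups to combine with each nonempty \<open>I\<close>.
\<close>

lemma sum_full_rank_le:
  fixes n r :: nat and L \<epsilon> m s \<kappa> :: real and \<rho> :: "nat \<Rightarrow> nat \<Rightarrow> 'p::prime_card mod_ring \<Rightarrow> real"
  assumes \<rho>: "\<And>i j. i < n \<Longrightarrow> j < n \<Longrightarrow> step_dist (\<rho> j i)"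
    and \<epsilon>: "0 < \<epsilon>" "\<epsilon> < 1" and m: "0 \<le> m"
    and \<kappa>: "0 < \<kappa>" "\<And>x :: 'p mod_ring. x \<noteq> 0 \<Longrightarrow> \<kappa> \<le> 1 - Re (add_char x)"
  defines "L \<equiv> real (CARD('p) ^ r)"
  assumes s: "0 \<le> s" "L * s \<le> \<epsilon> / 2 * n"
  shows "(\<Sum>F\<in>full_rank r n. \<Prod>j<n. fourier_bound r n m (\<rho> j) F)
     \<le> main_factor L n m \<epsilon> (\<kappa> * s) * (1 + 2 ^ (CARD('p) ^ r) *
        (\<Sum>I | I \<subseteq> {..<n} \<and> I \<noteq> {} \<and> real (card I) \<le> L * s. ((1 + exp (- 2 * m * card I)) / 2) ^ n * L ^ card I))"
proof -
  let ?G = "carrier_vec r :: 'p mod_ring Matrix.vec set"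
  let ?D = "main_factor L n m \<epsilon> (\<kappa> * s)"
  let ?c = "\<lambda>I. ((1 + exp (- 2 * m * card I)) / 2) ^ n * L ^ card I"
  let ?Is = "{I. I \<subseteq> {..<n} \<and> I \<noteq> {} \<and> real (card I) \<le> L * s}"
  let ?Ks = "{K \<in> Pow ?G. vec_subgrp r K}"
  define \<Omega> where "\<Omega> = (\<lambda>(K, I). {F \<in> {..<n} \<rightarrow>\<^sub>E ?G. active n K F = I \<and>
      (\<forall>v\<in>?G - K. s \<le> card {i \<in> {..<n} - I. scalar_prod v (F i) \<noteq> 0})})"
  let ?f = "\<lambda>F. \<Prod>j<n. fourier_bound r n m (\<rho> j) F"
  \<comment> \<open>An empty support forces \<open>K = {0}\<close>, because a full rank matrix has no vanishing nontrivial combination of rows.\<close>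
  define J where "J = insert ({0\<^sub>v r}, {}) (?Ks \<times> ?Is)"
  have f0: "0 \<le> ?f F" for F
    by (intro prod_nonneg) (auto simp: fourier_bound_def intro!: divide_nonneg_nonneg sum_nonneg)
  have fin: "finite ?Is" by (rule finite_subset[of _ "Pow {..<n}"]) auto
  have finKs: "finite ?Ks" by simp
  have finJ: "finite J" using fin finKs by (simp add: J_def)
  have fin\<Omega>: "finite (\<Omega> x)" for x
  proof (rule finite_subset)
    show "\<Omega> x \<subseteq> {..<n} \<rightarrow>\<^sub>E ?G" by (auto simp: \<Omega>_def split: prod.splits)
    show "finite ({..<n} \<rightarrow>\<^sub>E ?G)" by (intro finite_PiE) auto
  qed
  have D0: "0 \<le> ?D" unfolding main_factor_def L_def by (auto intro!: add_nonneg_nonneg mult_nonneg_nonneg zero_le_power)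
  have sub: "full_rank r n \<subseteq> (\<Union>x\<in>J. \<Omega> x)"
  proof
    fix F assume F: "F \<in> (full_rank r n :: (nat \<Rightarrow> 'p mod_ring Matrix.vec) set)"
    have FG: "\<And>i. i < n \<Longrightarrow> F i \<in> ?G" using F by (auto simp: full_rank_def)
    obtain K where K: "vec_subgrp r K" "real (card (active n K F)) \<le> L * s"
      "\<And>v. v \<in> ?G - K \<Longrightarrow> s \<le> card {i \<in> {..<n} - active n K F. scalar_prod v (F i) \<noteq> 0}"
      using ex_degenerate_subgroup[where n=n and F=F and s=s and r=r] FG s(1) unfolding L_def by blast
    have FO: "F \<in> \<Omega> (K, active n K F)" using K(3) F by (simp add: \<Omega>_def full_rank_def)
    show "F \<in> (\<Union>x\<in>J. \<Omega> x)"
    proof (cases "active n K F = {}")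
      case True
      have "K = {0\<^sub>v r}"
      proof (rule ccontr)
        assume "K \<noteq> {0\<^sub>v r}"
        then obtain v where "v \<in> K" "v \<noteq> 0\<^sub>v r" using K(1) by (auto simp: vec_subgrp_def)
        moreover from this have "v \<in> ?G" using K(1) by (auto simp: vec_subgrp_def)
        ultimately obtain i where "i < n" "scalar_prod v (F i) \<noteq> 0" using F by (auto simp: full_rank_def)
        then show False using True \<open>v \<in> K\<close> by (auto simp: active_def)
      qed
      then show ?thesis using FO True by (force simp: J_def)
    next
      case False
      have "(K, active n K F) \<in> J" using False K by (auto simp: J_def vec_subgrp_def active_def)
      then show ?thesis using FO by blast
    qed
  qed
  have str: "(\<Sum>F\<in>\<Omega> x. ?f F) \<le> ?c (snd x) * ?D" if "x \<in> J" for x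
  proof -
    obtain K I where x: "x = (K, I)" by force
    have K: "vec_subgrp r K" using that by (auto simp: J_def x vec_subgrp_def)
    have I: "I \<subseteq> {..<n}" "card I \<le> L * s"
      using that s by (auto simp: J_def x L_def)
    then have "real (card I) \<le> \<epsilon> / 2 * n" using s by linarith
    then show ?thesis using sum_stratum_le[where \<rho>=\<rho> and s=s and \<kappa>=\<kappa> and n=n, OF K \<rho> \<epsilon> m I(1) _ \<kappa>] unfolding x L_def \<Omega>_def by simp
  qed
  have "(\<Sum>F\<in>full_rank r n. ?f F) \<le> (\<Sum>F\<in>(\<Union>x\<in>J. \<Omega> x). ?f F)"
    using sub finJ fin\<Omega> f0 by (intro sum_mono2) auto
  also have "\<dots> \<le> (\<Sum>x\<in>J. \<Sum>F\<in>\<Omega> x. ?f F)"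
    using f0 finJ fin\<Omega> by (intro sum_UN_le) auto
  also have "\<dots> \<le> (\<Sum>x\<in>J. ?c (snd x) * ?D)" by (intro sum_mono str)
  also have "\<dots> = ?D * (?c {} + (\<Sum>x\<in>?Ks \<times> ?Is. ?c (snd x)))"
    unfolding J_def using fin finKs by (subst sum.insert) (auto simp: algebra_simps sum_distrib_left)
  also have "(\<Sum>x\<in>?Ks \<times> ?Is. ?c (snd x)) = card ?Ks * (\<Sum>I\<in>?Is. ?c I)"
    using sum.cartesian_product[of "\<lambda>K I. ?c I" ?Is ?Ks] by (simp add: case_prod_unfold)
  also have "?D * (?c {} + card ?Ks * (\<Sum>I\<in>?Is. ?c I)) \<le> ?D * (1 + 2 ^ (CARD('p) ^ r) * (\<Sum>I\<in>?Is. ?c I))"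
  proof (intro mult_left_mono D0 add_mono mult_right_mono)
    have "card ?Ks \<le> card (Pow ?G)" by (rule card_mono) auto
    also have "card (Pow ?G) = 2 ^ (CARD('p) ^ r)" by (simp add: card_Pow card_vec)
    finally show "real (card ?Ks) \<le> 2 ^ (CARD('p) ^ r)" by (metis of_nat_le_iff of_nat_numeral of_nat_power)
  qed (auto simp: L_def intro!: sum_nonneg mult_nonneg_nonneg zero_le_power)
  finally show ?thesis .
qed

text \<open>
  Typical \<open>F\<close>, for which all gap sums are at least \<open>(1 - \<epsilon>) * n\<close>, have full rank because a vanishing
  combination would have gap sum 0.
\<close>

lemma sum_full_rank_ge:
  fixes n r :: nat and L \<epsilon> m :: real and \<rho> :: "nat \<Rightarrow> nat \<Rightarrow> 'p::prime_card mod_ring \<Rightarrow> real"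
  assumes \<rho>: "\<And>i j. i < n \<Longrightarrow> j < n \<Longrightarrow> step_dist (\<rho> j i)"
    and \<epsilon>: "0 < \<epsilon>" "\<epsilon> < 1" and m: "0 \<le> m" and n: "0 < n"
  defines "L \<equiv> real (CARD('p) ^ r)"
  assumes small: "L * exp (- m * ((1 - \<epsilon>) * n)) \<le> 1"
    and P0: "\<And>F j. 0 \<le> P F j"
    and P: "\<And>F j. j < n \<Longrightarrow> F \<in> {..<n} \<rightarrow>\<^sub>E carrier_vec r \<Longrightarrow>
       (1 - (\<Sum>v\<in>carrier_vec r - {0\<^sub>v r}. exp (- m * (\<Sum>i<n. gap (\<rho> j i) (scalar_prod v (F i)))))) / L \<le> P F j"
  shows "(1 - n * L * exp (- \<epsilon>\<^sup>2 / 16 * n)) * (1 - L * exp (- m * ((1 - \<epsilon>) * n))) ^ n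
    \<le> (\<Sum>F\<in>full_rank r n. \<Prod>j<n. P F j)"
proof -
  let ?G = "carrier_vec r :: 'p mod_ring Matrix.vec set" and ?Z = "{0\<^sub>v r} :: 'p mod_ring Matrix.vec set"
  let ?S = "\<lambda>j v F. \<Sum>i<n. gap (\<rho> j i) (scalar_prod v (F i))"
  let ?P = "{..<n} \<rightarrow>\<^sub>E ?G"
  let ?low = "\<lambda>j v. {F \<in> ?P. ?S j v F < (1 - \<epsilon>) * n}"
  let ?\<tau> = "exp (- \<epsilon>\<^sup>2 / 16 * n)"
  let ?e = "exp (- m * ((1 - \<epsilon>) * n))"
  define bad where "bad = (\<Union>j<n. \<Union>v\<in>?G - ?Z. ?low j v)"
  have Z: "vec_subgrp r ?Z" by (simp add: vec_subgrp_def)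
  have annZ: "annih r ?Z = ?G" by (auto simp: annih_def)
  have finP: "finite ?P" by (intro finite_PiE) auto
  have L: "0 < L" by (simp add: L_def)
  have badP: "bad \<subseteq> ?P" by (auto simp: bad_def)
  have cG: "card (?G - ?Z) \<le> L"
  proof -
    have "card (?G - ?Z) \<le> CARD('p) ^ r" unfolding card_vec[symmetric] by (intro card_mono) auto
    then show ?thesis unfolding L_def by (simp only: of_nat_le_iff)
  qed
  have card_bad: "card bad \<le> n * L * ?\<tau> * card ?P"
    using card_ex_gap_sum_small[OF Z, where n=n and \<rho>=\<rho> and \<epsilon>=\<epsilon> and I="{}"] \<rho> \<epsilon>
    by (simp add: bad_def L_def annZ)
  have good: "(1 - \<epsilon>) * n \<le> ?S j v F" if "F \<in> ?P - bad" "j < n" "v \<in> ?G - ?Z" for F j v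
    using that by (force simp: bad_def)
  have sub: "?P - bad \<subseteq> full_rank r n"
  proof
    fix F assume F: "F \<in> ?P - bad"
    have "\<exists>i<n. scalar_prod v (F i) \<noteq> 0" if v: "v \<in> ?G - ?Z" for v
    proof (rule ccontr)
      assume "\<not> (\<exists>i<n. scalar_prod v (F i) \<noteq> 0)"
      then have "?S 0 v F = 0" by simp
      moreover have "0 < (1 - \<epsilon>) * n" using \<epsilon> n by simp
      ultimately show False using good[OF F n v] by linarith
    qed
    then show "F \<in> full_rank r n" using F by (simp add: full_rank_def)
  qed
  have pt: "((1 - L * ?e) / L) ^ n \<le> (\<Prod>j<n. P F j)" if F: "F \<in> ?P - bad" for F
  proof -
    have "(1 - L * ?e) / L \<le> P F j" if j: "j < n" for j
    proof -
      have "(\<Sum>v\<in>?G - ?Z. exp (- m * ?S j v F)) \<le> card (?G - ?Z) * ?e"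
        using good[OF F j] m by (intro sum_bounded_above) (simp add: mult_left_mono)
      also have "\<dots> \<le> L * ?e" by (intro mult_right_mono cG) simp
      finally have "(1 - L * ?e) / L \<le> (1 - (\<Sum>v\<in>?G - ?Z. exp (- m * ?S j v F))) / L"
        using L by (intro divide_right_mono) auto
      also have "\<dots> \<le> P F j" using P j F by simp
      finally show ?thesis .
    qed
    then have "(\<Prod>j<n. (1 - L * ?e) / L) \<le> (\<Prod>j<n. P F j)"
      using small L by (intro prod_mono) (auto intro!: divide_nonneg_nonneg)
    then show ?thesis by simp
  qed
  have cP: "real (card ?P) = L ^ n" by (simp add: card_PiE card_vec L_def)
  have "(1 - n * L * ?\<tau>) * (1 - L * ?e) ^ n = (1 - n * L * ?\<tau>) * card ?P * ((1 - L * ?e) / L) ^ n"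
    using L by (simp add: cP power_divide)
  also have "\<dots> \<le> card (?P - bad) * ((1 - L * ?e) / L) ^ n"
  proof (rule mult_right_mono)
    have "card (?P - bad) = card ?P - card bad" "card bad \<le> card ?P"
      using badP finP by (auto intro: card_Diff_subset finite_subset card_mono)
    then have "real (card (?P - bad)) = real (card ?P) - real (card bad)" by (simp add: of_nat_diff)
    then show "(1 - n * L * ?\<tau>) * card ?P \<le> card (?P - bad)" using card_bad by (simp add: algebra_simps)
    show "0 \<le> ((1 - L * ?e) / L) ^ n" using small L by (intro zero_le_power divide_nonneg_nonneg) auto
  qed
  also have "\<dots> = (\<Sum>F\<in>?P - bad. ((1 - L * ?e) / L) ^ n)" by simp
  also have "\<dots> \<le> (\<Sum>F\<in>?P - bad. \<Prod>j<n. P F j)" by (intro sum_mono pt)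
  also have "\<dots> \<le> (\<Sum>F\<in>full_rank r n. \<Prod>j<n. P F j)"
  proof (intro sum_mono2 sub)
    show "finite (full_rank r n :: (nat \<Rightarrow> 'p mod_ring Matrix.vec) set)"
      by (rule finite_subset[OF _ finP]) (auto simp: full_rank_def)
  qed (auto intro: prod_nonneg P0)
  finally show ?thesis .
qed

section \<open>Asymptotics at the threshold\<close>

lemma sum_Pow_power_card:
  assumes "finite A" shows "(\<Sum>I\<in>Pow A. x ^ card I) = (1 + x :: real) ^ card A"
proof -
  have "(\<Prod>i\<in>A. x + 1) = (\<Sum>I\<in>Pow A. (\<Prod>i\<in>I. x) * (\<Prod>i\<in>A - I. 1))"
    using assms by (rule prod_add)
  then show ?thesis by (simp add: add.commute)
qed

text \<open>
  A convenient form of the two regimes: \<open>1 - exp (- x) \<ge> (1 - \<epsilon>) * x\<close> as long as \<open>x = 2 * m * w\<close> is at most \<open>2 * \<epsilon>\<close>, and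
  \<open>1 - exp (- x)\<close> is bounded below by a constant beyond that.
\<close>

lemma half_power_le:
  fixes m \<epsilon> :: real and n w :: nat
  assumes m: "0 \<le> m" and \<epsilon>: "0 < \<epsilon>" "\<epsilon> < 1"
  shows "((1 + exp (- 2 * m * w)) / 2) ^ n
     \<le> exp (- m * ((1 - \<epsilon>) * n)) ^ w + exp (- ((1 - exp (- 2 * \<epsilon>)) / 2) * n)"
proof (cases "m * w \<le> \<epsilon>")
  case True
  let ?x = "2 * m * w"
  have x: "0 \<le> ?x" "?x \<le> 2 * \<epsilon>" using m True by auto
  have "?x\<^sup>2 / 2 \<le> \<epsilon> * ?x" using mult_right_mono[OF x(2,1)] by (simp add: power2_eq_square mult_ac)
  then have "exp (- ?x) \<le> 1 - (1 - \<epsilon>) * ?x" using exp_minus_le[OF x(1)] by (simp add: algebra_simps)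
  then have "(1 + exp (- 2 * m * w)) / 2 \<le> 1 + - ((1 - \<epsilon>) * (m * w))" by (simp add: field_simps)
  also have "\<dots> \<le> exp (- ((1 - \<epsilon>) * (m * w)))" by (rule exp_ge_add_one_self)
  finally have "((1 + exp (- 2 * m * w)) / 2) ^ n \<le> exp (- ((1 - \<epsilon>) * (m * w))) ^ n"
    by (intro power_mono) (auto intro: add_nonneg_nonneg)
  also have "\<dots> = exp (- m * ((1 - \<epsilon>) * n)) ^ w"
    by (simp add: mult_ac flip: exp_of_nat_mult)
  finally show ?thesis by (simp add: add_increasing2)
next
  case False
  have "(1 + exp (- 2 * m * w)) / 2 \<le> 1 + - ((1 - exp (- 2 * \<epsilon>)) / 2)"
  proof -
    have "exp (- 2 * m * w) \<le> exp (- 2 * \<epsilon>)" using False by simp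
    then show ?thesis by (simp add: field_simps)
  qed
  also have "\<dots> \<le> exp (- ((1 - exp (- 2 * \<epsilon>)) / 2))" by (rule exp_ge_add_one_self)
  finally have "((1 + exp (- 2 * m * w)) / 2) ^ n \<le> exp (- ((1 - exp (- 2 * \<epsilon>)) / 2)) ^ n"
    by (intro power_mono) (auto intro: add_nonneg_nonneg)
  also have "\<dots> = exp (- ((1 - exp (- 2 * \<epsilon>)) / 2) * n)"
    by (simp add: mult_ac flip: exp_of_nat_mult)
  finally show ?thesis by (simp add: add_increasing)
qed

text \<open>
  Summing \<open>x ^ card I\<close> over all \<open>I\<close> gives \<open>(1 + x) ^ n\<close>, which handles the first regime of \<open>half_power_le\<close> without
  binomial estimates. In the second regime, weighting by \<open>z ^ card I\<close> with \<open>z \<le> 1\<close> exploits that \<open>card I \<le> t\<close>: the weight is at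
  least \<open>exp (t * ln z)\<close>.
\<close>

lemma sum_small_support_le:
  fixes m \<epsilon> L z t :: real and n :: nat
  assumes m: "0 \<le> m" and \<epsilon>: "0 < \<epsilon>" "\<epsilon> < 1" and L: "0 < L" and z: "0 < z" "z \<le> 1"
  shows "(\<Sum>I | I \<subseteq> {..<n} \<and> I \<noteq> {} \<and> real (card I) \<le> t. ((1 + exp (- 2 * m * card I)) / 2) ^ n * L ^ card I)
    \<le> ((1 + L * exp (- m * ((1 - \<epsilon>) * n))) ^ n - 1)
      + exp (- ((1 - exp (- 2 * \<epsilon>)) / 2) * n - t * ln z + L * z * n)"
proof -
  let ?Is = "{I. I \<subseteq> {..<n} \<and> I \<noteq> {} \<and> real (card I) \<le> t}"
  let ?y = "exp (- m * ((1 - \<epsilon>) * n))"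
  let ?\<theta> = "(1 - exp (- 2 * \<epsilon>)) / 2"
  have "(\<Sum>I\<in>?Is. ((1 + exp (- 2 * m * card I)) / 2) ^ n * L ^ card I)
    \<le> (\<Sum>I\<in>?Is. (L * ?y) ^ card I + exp (- ?\<theta> * n) * exp (- t * ln z) * (L * z) ^ card I)"
  proof (rule sum_mono)
    fix I assume I: "I \<in> ?Is"
    let ?w = "card I"
    have "((1 + exp (- 2 * m * ?w)) / 2) ^ n * L ^ ?w \<le> (?y ^ ?w + exp (- ?\<theta> * n)) * L ^ ?w"
      using L by (intro mult_right_mono half_power_le m \<epsilon>) auto
    also have "\<dots> = (L * ?y) ^ ?w + exp (- ?\<theta> * n) * 1 * L ^ ?w"
      by (simp add: power_mult_distrib algebra_simps)
    also have "\<dots> \<le> (L * ?y) ^ ?w + exp (- ?\<theta> * n) * (exp (- t * ln z) * z ^ ?w) * L ^ ?w"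
    proof (intro add_left_mono mult_right_mono mult_left_mono)
      have "z ^ ?w = exp (?w * ln z)" using z by (simp add: exp_of_nat_mult)
      then have "exp (- t * ln z) * z ^ ?w = exp ((t - ?w) * - ln z)"
        by (simp add: algebra_simps flip: exp_add)
      moreover have "0 \<le> (t - ?w) * - ln z" using I z by (intro mult_nonneg_nonneg) auto
      ultimately show "1 \<le> exp (- t * ln z) * z ^ ?w" by simp
    qed (use L in auto)
    finally show "((1 + exp (- 2 * m * ?w)) / 2) ^ n * L ^ ?w
       \<le> (L * ?y) ^ ?w + exp (- ?\<theta> * n) * exp (- t * ln z) * (L * z) ^ ?w"
      by (simp add: power_mult_distrib mult_ac)
  qed
  also have "\<dots> \<le> (\<Sum>I\<in>Pow {..<n} - {{}}. (L * ?y) ^ card I + exp (- ?\<theta> * n) * exp (- t * ln z) * (L * z) ^ card I)"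
    using L z by (intro sum_mono2) (auto intro!: add_nonneg_nonneg)
  also have "\<dots> = (\<Sum>I\<in>Pow {..<n} - {{}}. (L * ?y) ^ card I) + exp (- ?\<theta> * n) * exp (- t * ln z) * (\<Sum>I\<in>Pow {..<n} - {{}}. (L * z) ^ card I)"
    by (simp add: sum.distrib sum_distrib_left)
  also have "\<dots> \<le> ((1 + L * ?y) ^ n - 1) + exp (- ?\<theta> * n) * exp (- t * ln z) * exp (L * z * n)"
  proof (intro add_mono mult_left_mono)
    have *: "(\<Sum>I\<in>Pow {..<n} - {{}}. x ^ card I) = (1 + x) ^ n - 1" for x :: real
      using sum_Pow_power_card[of "{..<n}" x] by (simp add: sum_diff1)
    show "(\<Sum>I\<in>Pow {..<n} - {{}}. (L * ?y) ^ card I) \<le> (1 + L * ?y) ^ n - 1" by (simp add: *)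
    have "(1 + L * z) ^ n \<le> exp (L * z) ^ n" using L z by (intro power_mono exp_ge_add_one_self) auto
    also have "\<dots> = exp (L * z * n)" by (simp add: mult_ac flip: exp_of_nat_mult)
    finally show "(\<Sum>I\<in>Pow {..<n} - {{}}. (L * z) ^ card I) \<le> exp (L * z * n)" by (simp add: *)
  qed auto
  also have "exp (- ?\<theta> * n) * exp (- t * ln z) * exp (L * z * n) = exp (- ?\<theta> * n - t * ln z + L * z * n)"
    by (simp flip: exp_add)
  finally show ?thesis .
qed

lemma power_tendsto_1:
  fixes x :: "nat \<Rightarrow> real"
  assumes x: "\<forall>\<^sub>F n in sequentially. 0 \<le> x n \<and> x n \<le> L * n powr (- c)" and c: "1 < c"
  shows "(\<lambda>n. (1 + x n) ^ n) \<longlonglongrightarrow> 1" "(\<lambda>n. (1 - x n) ^ n) \<longlonglongrightarrow> 1"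
proof -
  have lim: "(\<lambda>n. L * real n powr (1 - c)) \<longlonglongrightarrow> 0" using c by real_asymp
  have nx: "\<forall>\<^sub>F n in sequentially. n * x n \<le> L * real n powr (1 - c)"
    using x eventually_gt_at_top[of 0]
  proof eventually_elim
    case (elim n)
    then have "n * x n \<le> n * (L * n powr (- c))" by (intro mult_left_mono) auto
    also have "\<dots> = L * (n powr 1 * n powr (- c))" using elim by simp
    also have "\<dots> = L * n powr (1 - c)" unfolding powr_add[symmetric] by simp
    finally show ?case .
  qed
  show "(\<lambda>n. (1 + x n) ^ n) \<longlonglongrightarrow> 1"
  proof (rule tendsto_sandwich)
    show "\<forall>\<^sub>F n in sequentially. 1 \<le> (1 + x n) ^ n" using x by eventually_elim (simp add: one_le_power)
    show "\<forall>\<^sub>F n in sequentially. (1 + x n) ^ n \<le> exp (L * real n powr (1 - c))" using x nx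
    proof eventually_elim
      case (elim n)
      have "(1 + x n) ^ n \<le> exp (x n) ^ n" using elim by (intro power_mono exp_ge_add_one_self) auto
      also have "\<dots> = exp (n * x n)" by (simp add: exp_of_nat_mult)
      finally show ?case using elim by (meson exp_le_cancel_iff order_trans)
    qed
    show "(\<lambda>n. exp (L * real n powr (1 - c))) \<longlonglongrightarrow> 1" using tendsto_exp[OF lim] by simp
  qed simp
  have x1: "\<forall>\<^sub>F n in sequentially. x n \<le> 1"
  proof -
    have "\<forall>\<^sub>F n in sequentially. L * real n powr (1 - c) < 1" using lim by (rule order_tendstoD) simp
    then show ?thesis using x nx eventually_gt_at_top[of 0]
    proof eventually_elim
      case (elim n)
      then have "1 * x n \<le> n * x n" by (intro mult_right_mono) auto
      then show ?case using elim by simp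
    qed
  qed
  show "(\<lambda>n. (1 - x n) ^ n) \<longlonglongrightarrow> 1"
  proof (rule tendsto_sandwich)
    show "\<forall>\<^sub>F n in sequentially. 1 - L * real n powr (1 - c) \<le> (1 - x n) ^ n" using x1 nx
    proof eventually_elim
      case (elim n)
      then show ?case using Bernoulli_inequality[of "- x n" n] by simp
    qed
    show "\<forall>\<^sub>F n in sequentially. (1 - x n) ^ n \<le> 1" using x x1 by eventually_elim (simp add: power_le_one)
    show "(\<lambda>n. 1 - L * real n powr (1 - c)) \<longlonglongrightarrow> 1" using tendsto_diff[OF tendsto_const lim, of 1] by simp
  qed simp
qed

text \<open>
  Here \<open>L * exp (- m n * ((1 - \<epsilon>) * n))\<close> is at most \<open>L * n powr (- c1)\<close> for some \<open>c1 > 1\<close>, since \<open>m n * n\<close> is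
  asymptotically \<open>c * ln n\<close>; this is the only place where the size of \<open>c\<close> matters. All other error terms carry a factor that is
  exponentially small in \<open>n\<close>, against a growth of at most \<open>exp (o(n))\<close> or an entropy made small by the choice of \<open>\<delta>\<close>.
\<close>

lemma threshold_parameters:
  fixes c \<kappa> L C :: real and \<alpha> m :: "nat \<Rightarrow> real"
  assumes c: "1 < c" and \<kappa>: "0 < \<kappa>" and L: "1 \<le> L" and C: "0 \<le> C"
  defines "\<alpha> \<equiv> \<lambda>n::nat. c * ln n / n"
  defines "m \<equiv> \<lambda>n::nat. \<alpha> n * (1 - \<alpha> n)"
  shows "\<exists>(\<epsilon>::real) (\<delta>::real). 0 < \<epsilon> \<and> \<epsilon> < 1 \<and> 0 < \<delta> \<and> L * \<delta> \<le> \<epsilon> / 2 \<and>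
    (\<forall>\<^sub>F n in sequentially. L * exp (- m n * ((1 - \<epsilon>) * n)) \<le> 1) \<and>
    (\<lambda>n. (1 - n * L * exp (- \<epsilon>\<^sup>2 / 16 * n)) * (1 - L * exp (- m n * ((1 - \<epsilon>) * n))) ^ n) \<longlonglongrightarrow> 1 \<and>
    (\<lambda>n. main_factor L n (m n) \<epsilon> (\<kappa> * (\<delta> * n)) * (1 + C *
       (\<Sum>I | I \<subseteq> {..<n} \<and> I \<noteq> {} \<and> real (card I) \<le> L * (\<delta> * n).
          ((1 + exp (- 2 * m n * card I)) / 2) ^ n * L ^ card I))) \<longlonglongrightarrow> 1"
proof -
  \<comment> \<open>Small enough for \<open>c * (1 - \<epsilon>)\<^sup>2 > 1\<close>: one factor \<open>1 - \<epsilon>\<close> pays for the deviation of the gap sums, the other for \<open>1 - \<alpha> n\<close>.\<close>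
  define \<epsilon> where "\<epsilon> = (1 - 1 / c) / 3"
  have \<epsilon>: "0 < \<epsilon>" "\<epsilon> < 1" using c by (auto simp: \<epsilon>_def field_simps)
  define c1 where "c1 = c * (1 - \<epsilon>)\<^sup>2"
  have c1: "1 < c1"
  proof -
    have "1 < c * (1 - 2 * \<epsilon>)" using c by (simp add: \<epsilon>_def field_simps)
    also have "\<dots> \<le> c * (1 - \<epsilon>)\<^sup>2" using c by (intro mult_left_mono) (auto simp: power2_eq_square algebra_simps)
    finally show ?thesis by (simp add: c1_def)
  qed
  define \<theta> where "\<theta> = (1 - exp (- 2 * \<epsilon>)) / 2"
  have \<theta>: "0 < \<theta>" "\<theta> < 1" using \<epsilon> by (auto simp: \<theta>_def field_simps add_pos_pos intro: less_trans[of _ 0])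
  \<comment> \<open>With these choices of \<open>z\<close> and \<open>\<delta>\<close> the entropy terms \<open>L * z\<close> and \<open>- L * \<delta> * ln z\<close> are at most \<open>\<theta> / 4\<close> each.\<close>
  define z where "z = \<theta> / (4 * L)"
  have z: "0 < z" "z < 1" using \<theta> L by (auto simp: z_def field_simps)
  define \<delta> where "\<delta> = min (\<epsilon> / 2 / L) (\<theta> / (4 * L * (- ln z)))"
  have lnz: "0 < - ln z" using z by simp
  have \<delta>: "0 < \<delta>" unfolding \<delta>_def min_less_iff_conj
    using \<epsilon> L \<theta> lnz by (intro conjI divide_pos_pos mult_pos_pos) auto
  have \<delta>1: "L * \<delta> \<le> \<epsilon> / 2"
  proof -
    have "L * \<delta> \<le> L * (\<epsilon> / 2 / L)" using L by (intro mult_left_mono) (auto simp: \<delta>_def)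
    then show ?thesis using L by simp
  qed
  have \<delta>2: "L * \<delta> * (- ln z) \<le> \<theta> / 4"
  proof -
    have "L * (- ln z) * \<delta> \<le> L * (- ln z) * (\<theta> / (4 * L * (- ln z)))"
      using L lnz by (intro mult_left_mono mult_nonneg_nonneg) (auto simp: \<delta>_def)
    also have "\<dots> = \<theta> / 4" using L lnz by simp
    finally show ?thesis by (simp add: mult_ac)
  qed
  define g where "g = c * (1 - \<epsilon>) * (\<kappa> * \<delta>)"
  have g: "0 < g" using c \<epsilon> \<kappa> \<delta> by (simp add: g_def)
  have "\<alpha> \<longlonglongrightarrow> 0" unfolding \<alpha>_def by real_asymp
  then have \<alpha>: "\<forall>\<^sub>F n in sequentially. \<alpha> n < \<epsilon>" using \<epsilon> by (intro order_tendstoD)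
  have decay: "\<forall>\<^sub>F n in sequentially. exp (- m n * (a * n)) \<le> n powr (- (c * (1 - \<epsilon>) * a)) \<and> 0 \<le> m n" if a: "0 \<le> a" for a :: real
    using \<alpha> eventually_gt_at_top[of 1]
  proof eventually_elim
    case (elim n)
    have m: "(1 - \<epsilon>) * (c * ln n) \<le> m n * n"
    proof -
      have "m n * n = (1 - \<alpha> n) * (c * ln n)" using elim by (simp add: m_def \<alpha>_def)
      then show ?thesis using elim c by (simp add: mult_right_mono)
    qed
    then have "(1 - \<epsilon>) * (c * ln n) * a \<le> m n * n * a" using a by (rule mult_right_mono)
    then have "exp (- m n * (a * n)) \<le> exp (- (c * (1 - \<epsilon>) * a) * ln n)" by (simp add: mult_ac)
    also have "\<dots> = n powr (- (c * (1 - \<epsilon>) * a))" using elim by (simp add: powr_def)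
    finally have 1: "exp (- m n * (a * n)) \<le> n powr (- (c * (1 - \<epsilon>) * a))" .
    have "0 \<le> \<alpha> n" using elim c by (simp add: \<alpha>_def)
    then have "0 \<le> m n" using elim \<epsilon> by (simp add: m_def)
    with 1 show ?case by simp
  qed
  let ?x = "\<lambda>n. L * exp (- m n * ((1 - \<epsilon>) * n))"
  let ?x1 = "\<lambda>n. L * exp (- m n * (\<kappa> * (\<delta> * n)))"
  have "\<forall>\<^sub>F n in sequentially. 0 \<le> ?x n \<and> ?x n \<le> L * n powr (- c1)"
  proof -
    have "0 \<le> 1 - \<epsilon>" using \<epsilon> by simp
    from decay[OF this] show ?thesis
    proof eventually_elim
      case (elim n)
      then show ?case using L by (simp add: c1_def power2_eq_square mult.assoc)
    qed
  qed
  note x = power_tendsto_1[OF this c1] this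
  have x1: "\<forall>\<^sub>F n in sequentially. ?x1 n \<le> L * n powr (- g)"
  proof -
    have "\<forall>\<^sub>F n in sequentially. exp (- m n * (\<kappa> * \<delta> * n)) \<le> n powr (- (c * (1 - \<epsilon>) * (\<kappa> * \<delta>))) \<and> 0 \<le> m n"
      using \<kappa> \<delta> by (intro decay) simp
    then show ?thesis
    proof eventually_elim
      case (elim n)
      then show ?case using L by (simp add: g_def mult_ac)
    qed
  qed
  have xsmall: "\<forall>\<^sub>F n in sequentially. ?x n \<le> 1"
  proof -
    have "(\<lambda>n. L * real n powr (- c1)) \<longlonglongrightarrow> 0" using c1 by real_asymp
    then have "\<forall>\<^sub>F n in sequentially. L * real n powr (- c1) < 1" by (rule order_tendstoD) simp
    then show ?thesis using x(3) by eventually_elim linarith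
  qed
  have low: "(\<lambda>n. (1 - n * L * exp (- \<epsilon>\<^sup>2 / 16 * n)) * (1 - ?x n) ^ n) \<longlonglongrightarrow> 1"
  proof -
    define q where "q = \<epsilon>\<^sup>2 / 16"
    have q: "0 < q" using \<epsilon> by (simp add: q_def)
    have "(\<lambda>n::nat. 1 - n * L * exp (- q * n)) \<longlonglongrightarrow> 1" using q by real_asymp
    then show ?thesis using tendsto_mult[OF _ x(2), of "\<lambda>n. 1 - n * L * exp (- q * n)" 1] by (simp add: q_def)
  qed
  have main: "(\<lambda>n. main_factor L n (m n) \<epsilon> (\<kappa> * (\<delta> * n))) \<longlonglongrightarrow> 1"
  proof -
    define q where "q = \<epsilon>\<^sup>2 / 16"
    have q: "0 < q" using \<epsilon> by (simp add: q_def)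
    have "(\<lambda>n. n * L * exp (- q * n) * (1 + ?x1 n) ^ n) \<longlonglongrightarrow> 0"
    proof (rule tendsto_sandwich)
      show "\<forall>\<^sub>F n in sequentially. 0 \<le> n * L * exp (- q * n) * (1 + ?x1 n) ^ n"
        using L by (intro always_eventually allI mult_nonneg_nonneg zero_le_power add_nonneg_nonneg) auto
      show "\<forall>\<^sub>F n in sequentially. n * L * exp (- q * n) * (1 + ?x1 n) ^ n \<le> n * L * exp (n * (L * n powr (- g) - q))"
        using x1
      proof eventually_elim
        case (elim n)
        have "(1 + ?x1 n) ^ n \<le> exp (L * n powr (- g)) ^ n"
          using L elim exp_ge_add_one_self[of "L * n powr (- g)"] by (intro power_mono) (linarith, auto intro: add_nonneg_nonneg)
        also have "\<dots> = exp (n * (L * n powr (- g)))" by (simp add: exp_of_nat_mult)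
        finally have "n * L * exp (- q * n) * (1 + ?x1 n) ^ n \<le> n * L * exp (- q * n) * exp (n * (L * n powr (- g)))"
          using L by (intro mult_left_mono) auto
        also have "\<dots> = n * L * exp (n * (L * n powr (- g) - q))" by (simp add: algebra_simps flip: exp_add)
        finally show ?case .
      qed
      have "(\<lambda>n. L * real n powr (- g) - q) \<longlonglongrightarrow> - q" using g by real_asymp
      then have "\<forall>\<^sub>F n in sequentially. L * real n powr (- g) - q < - q / 2" using q by (intro order_tendstoD) auto
      then have ev: "\<forall>\<^sub>F n in sequentially. n * L * exp (n * (L * n powr (- g) - q)) \<le> n * L * exp (- q / 2 * n)"
      proof eventually_elim
        case (elim n)
        then have "n * (L * n powr (- g) - q) \<le> n * (- q / 2)" by (intro mult_left_mono) auto
        then show ?case using L by (intro mult_left_mono) (auto simp: mult_ac)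
      qed
      show "(\<lambda>n. n * L * exp (n * (L * n powr (- g) - q))) \<longlonglongrightarrow> 0"
      proof (rule tendsto_sandwich[OF _ ev tendsto_const])
        show "\<forall>\<^sub>F n in sequentially. 0 \<le> n * L * exp (n * (L * n powr (- g) - q))" using L by simp
        show "(\<lambda>n. real n * L * exp (- q / 2 * real n)) \<longlonglongrightarrow> 0" using q by real_asymp
      qed
    qed simp
    from tendsto_add[OF x(1) this] show ?thesis by (simp add: main_factor_def q_def)
  qed
  let ?\<Sigma> = "\<lambda>n. \<Sum>I | I \<subseteq> {..<n} \<and> I \<noteq> {} \<and> real (card I) \<le> L * (\<delta> * n).
          ((1 + exp (- 2 * m n * card I)) / 2) ^ n * L ^ card I"
  have "?\<Sigma> \<longlonglongrightarrow> 0"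
  proof (rule tendsto_sandwich)
    show "\<forall>\<^sub>F n in sequentially. 0 \<le> ?\<Sigma> n"
      using L by (intro always_eventually allI sum_nonneg mult_nonneg_nonneg zero_le_power) auto
    show "\<forall>\<^sub>F n in sequentially. ?\<Sigma> n \<le> ((1 + ?x n) ^ n - 1) + exp (- (\<theta> / 2) * n)"
      \<comment> \<open>For the exponent 0 this just records that \<open>m n\<close> is eventually nonnegative.\<close>
      using decay[OF order_refl]
    proof eventually_elim
      case (elim n)
      have "?\<Sigma> n \<le> ((1 + ?x n) ^ n - 1) + exp (- \<theta> * n - L * (\<delta> * n) * ln z + L * z * n)"
        using sum_small_support_le[where m="m n" and \<epsilon>=\<epsilon> and L=L and z=z and t="L * (\<delta> * n)" and n=n]
          elim \<epsilon> L z unfolding \<theta>_def by simp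
      also have "- \<theta> * n - L * (\<delta> * n) * ln z + L * z * n = (- \<theta> + L * \<delta> * (- ln z) + \<theta> / 4) * n"
        using L by (simp add: z_def algebra_simps)
      also have "\<dots> \<le> - (\<theta> / 2) * n" using \<delta>2 by (intro mult_right_mono) auto
      finally show ?case by simp
    qed
    have "(\<lambda>n::nat. exp (- (\<theta> / 2) * n)) \<longlonglongrightarrow> 0" using \<theta>(1) by real_asymp
    from tendsto_add[OF tendsto_diff[OF x(1) tendsto_const, of 1] this]
    show "(\<lambda>n. ((1 + ?x n) ^ n - 1) + exp (- (\<theta> / 2) * n)) \<longlonglongrightarrow> 0" by simp
  qed simp
  from tendsto_mult[OF main tendsto_add[OF tendsto_const tendsto_mult[OF tendsto_const this], of 1 C]]
  have "(\<lambda>n. main_factor L n (m n) \<epsilon> (\<kappa> * (\<delta> * n)) * (1 + C * ?\<Sigma> n)) \<longlonglongrightarrow> 1" by simp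
  then show ?thesis using \<epsilon> \<delta> \<delta>1 xsmall low
    by (intro exI[of _ \<epsilon>] exI[of _ \<delta>] conjI)
qed

section \<open>Surjections from the cokernel as matrices\<close>

text \<open>
  The matrix with columns \<open>F 0, \<dots>, F (n - 1)\<close> applied to \<open>x\<close>.
\<close>

definition comb :: "nat \<Rightarrow> nat \<Rightarrow> (nat \<Rightarrow> 'a::field Matrix.vec) \<Rightarrow> 'a Matrix.vec \<Rightarrow> 'a Matrix.vec" where
  "comb r n F x = Matrix.vec r (\<lambda>k. \<Sum>i<n. vec_index x i * vec_index (F i) k)"

text \<open>
  The condition that the combination of the columns of \<open>F\<close> with coefficients \<open>a\<close> vanishes, tested against all
  functionals; this is the form that Fourier inversion needs.
\<close>

definition kills :: "nat \<Rightarrow> nat \<Rightarrow> (nat \<Rightarrow> 'a::field Matrix.vec) \<Rightarrow> (nat \<Rightarrow> 'a) \<Rightarrow> bool" where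
  "kills r n F a \<longleftrightarrow> (\<forall>v\<in>carrier_vec r. (\<Sum>i<n. a i * scalar_prod v (F i)) = 0)"

lemma comb_carrier [simp]: "comb r n F x \<in> carrier_vec r" by (simp add: comb_def)

lemma scalar_prod_comb:
  assumes "\<And>i. i < n \<Longrightarrow> F i \<in> carrier_vec r"
  shows "scalar_prod v (comb r n F x) = (\<Sum>i<n. vec_index x i * scalar_prod v (F i))"
proof -
  have "scalar_prod v (comb r n F x) = (\<Sum>k<r. \<Sum>i<n. vec_index x i * (vec_index v k * vec_index (F i) k))"
    by (simp add: scalar_prod_def comb_def sum_distrib_left mult_ac atLeast0LessThan)
  also have "\<dots> = (\<Sum>i<n. \<Sum>k<r. vec_index x i * (vec_index v k * vec_index (F i) k))" by (rule sum.swap)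
  also have "\<dots> = (\<Sum>i<n. vec_index x i * scalar_prod v (F i))"
    using carrier_vecD[OF assms] by (intro sum.cong refl) (auto simp: scalar_prod_def sum_distrib_left atLeast0LessThan)
  finally show ?thesis .
qed

lemma kills_iff_comb:
  assumes "\<And>i. i < n \<Longrightarrow> F i \<in> carrier_vec r" "\<And>i. i < n \<Longrightarrow> vec_index x i = a i"
  shows "kills r n F a \<longleftrightarrow> comb r n F x = 0\<^sub>v r"
proof -
  have "kills r n F a \<longleftrightarrow> (\<forall>v\<in>carrier_vec r. scalar_prod v (comb r n F x) = 0)"
    using assms by (simp add: kills_def scalar_prod_comb)
  also have "\<dots> \<longleftrightarrow> comb r n F x = 0\<^sub>v r"
    using ex_scalar_prod_nonzero[of "comb r n F x" r] by auto
  finally show ?thesis .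
qed

lemma comb_add:
  assumes "x \<in> carrier_vec n" "y \<in> carrier_vec n"
  shows "comb r n F (x + y) = comb r n F x + comb r n F y"
  using assms by (intro eq_vecI) (auto simp: comb_def ring_distribs sum.distrib)

lemma comb_zero: "comb r n F (0\<^sub>v n) = 0\<^sub>v r"
  by (intro eq_vecI) (auto simp: comb_def)

lemma comb_unit:
  assumes "j < n" "F j \<in> carrier_vec r"
  shows "comb r n F (unit_vec n j) = F j"
proof (rule eq_vecI)
  fix k assume "k < dim_vec (F j)"
  then have "vec_index (comb r n F (unit_vec n j)) k = (\<Sum>i<n. (if i = j then 1 else 0) * vec_index (F i) k)"
    using assms by (simp add: comb_def)
  also have "\<dots> = (\<Sum>i<n. (if i = j then vec_index (F i) k else 0))"
    by (intro sum.cong) auto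
  finally show "vec_index (comb r n F (unit_vec n j)) k = vec_index (F j) k" using assms by simp
qed (use assms in \<open>auto simp: comb_def\<close>)

text \<open>
  Duality replaces dimension arguments: a subgroup with trivial annihilator is everything, because the two
  cardinalities multiply to \<open>p\<^sup>r\<close>.
\<close>

lemma subgrp_eq_carrier:
  assumes K: "vec_subgrp r (K :: 'p::prime_card mod_ring Matrix.vec set)"
    and nd: "\<And>y. y \<in> carrier_vec r \<Longrightarrow> (\<And>u. u \<in> K \<Longrightarrow> scalar_prod u y = 0) \<Longrightarrow> y = 0\<^sub>v r"
  shows "K = carrier_vec r"
proof (rule card_subset_eq)
  show KG: "K \<subseteq> carrier_vec r" using K by (simp add: vec_subgrp_def)
  then have "annih r K = {0\<^sub>v r}" using nd by (auto simp: annih_def subset_iff)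
  then show "card K = card (carrier_vec r :: 'p mod_ring Matrix.vec set)"
    using card_annih[OF K] by (simp add: card_vec)
qed simp

lemma full_rank_iff_surj:
  fixes F :: "nat \<Rightarrow> 'p::prime_card mod_ring Matrix.vec"
  assumes F: "F \<in> {..<n} \<rightarrow>\<^sub>E carrier_vec r"
  shows "F \<in> full_rank r n \<longleftrightarrow> comb r n F ` carrier_vec n = carrier_vec r"
proof
  have FG: "\<And>i. i < n \<Longrightarrow> F i \<in> carrier_vec r" using F by auto
  {
    assume full: "F \<in> full_rank r n"
    show "comb r n F ` carrier_vec n = carrier_vec r"
    proof (rule subgrp_eq_carrier)
      show "vec_subgrp r (comb r n F ` carrier_vec n)"
        unfolding vec_subgrp_def
      proof (intro conjI ballI)
        show "0\<^sub>v r \<in> comb r n F ` carrier_vec n" by (rule image_eqI[of _ _ "0\<^sub>v n"]) (auto simp: comb_zero)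
        fix u v assume "u \<in> comb r n F ` carrier_vec n" "v \<in> comb r n F ` carrier_vec n"
        then obtain x y where "x \<in> carrier_vec n" "y \<in> carrier_vec n" "u = comb r n F x" "v = comb r n F y" by blast
        then show "u + v \<in> comb r n F ` carrier_vec n" by (intro image_eqI[of _ _ "x + y"]) (auto simp: comb_add)
      qed auto
      fix y :: "'p mod_ring Matrix.vec"
      assume y: "y \<in> carrier_vec r" and z: "\<And>u. u \<in> comb r n F ` carrier_vec n \<Longrightarrow> scalar_prod u y = 0"
      have "scalar_prod y (F i) = 0" if i: "i < n" for i
      proof -
        have "scalar_prod (comb r n F (unit_vec n i)) y = 0" by (rule z) simp
        then show ?thesis using y FG[OF i] i by (simp add: comb_unit comm_scalar_prod[of y r])
      qed
      then show "y = 0\<^sub>v r" using full y by (auto simp: full_rank_def)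
    qed
  next
    assume surj: "comb r n F ` carrier_vec n = carrier_vec r"
    have "\<exists>i<n. scalar_prod v (F i) \<noteq> 0" if v: "v \<in> carrier_vec r - {0\<^sub>v r}" for v
    proof -
      obtain y where y: "y \<in> carrier_vec r" "scalar_prod y v \<noteq> 0" using ex_scalar_prod_nonzero[of v r] v by blast
      then obtain x where "y = comb r n F x" using surj by blast
      then have "scalar_prod v (comb r n F x) \<noteq> 0" using y v comm_scalar_prod[of y r v] by simp
      then have "(\<Sum>i<n. vec_index x i * scalar_prod v (F i)) \<noteq> 0" using FG by (simp add: scalar_prod_comb)
      then obtain i where "i < n" "vec_index x i * scalar_prod v (F i) \<noteq> 0"
        by (meson lessThan_iff sum.not_neutral_contains_not_neutral)
      then show ?thesis by auto
    qed
    then show "F \<in> full_rank r n" using F by (simp add: full_rank_def)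
  }
qed

lemma comm_group_vec_group: "comm_group (vec_group n :: 'a::field Matrix.vec monoid)"
proof (rule comm_groupI)
  fix x :: "'a Matrix.vec" assume "x \<in> carrier (vec_group n)"
  then show "\<exists>y\<in>carrier (vec_group n). y \<otimes>\<^bsub>vec_group n\<^esub> x = \<one>\<^bsub>vec_group n\<^esub>"
    by (intro bexI[of _ "- x"]) (auto simp: vec_group_def)
qed (auto simp: vec_group_def comm_add_vec)

lemma mat_im_normal:
  fixes a :: "'a::field mat"
  assumes a: "a \<in> carrier_mat n n"
  shows "mat_im a \<lhd> vec_group n"
proof -
  interpret comm_group "vec_group n :: 'a Matrix.vec monoid" by (rule comm_group_vec_group)
  have dim: "dim_row a = n" "dim_col a = n" using a by auto
  have "subgroup (mat_im a) (vec_group n)"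
  proof (rule subgroupI)
    show "mat_im a \<subseteq> carrier (vec_group n)" using a by (auto simp: mat_im_def vec_group_def)
    have "a *\<^sub>v 0\<^sub>v n \<in> mat_im a" unfolding mat_im_def by (intro imageI) (simp add: dim)
    then show "mat_im a \<noteq> {}" by blast
    fix x assume "x \<in> mat_im a"
    then obtain u where u: "u \<in> carrier_vec n" "x = a *\<^sub>v u" by (auto simp: mat_im_def dim)
    then have "inv\<^bsub>vec_group n\<^esub> x = - x"
      using a by (intro inv_equality) (auto simp: vec_group_def)
    also have "- x = (- 1) \<cdot>\<^sub>v x" by auto
    also have "\<dots> = a *\<^sub>v ((- 1) \<cdot>\<^sub>v u)" using u a by (simp only: mult_mat_vec)
    finally show "inv\<^bsub>vec_group n\<^esub> x \<in> mat_im a" using u by (auto simp: mat_im_def dim)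
    fix y assume "y \<in> mat_im a"
    then obtain w where w: "w \<in> carrier_vec n" "y = a *\<^sub>v w" by (auto simp: mat_im_def dim)
    have "x \<otimes>\<^bsub>vec_group n\<^esub> y = a *\<^sub>v (u + w)" using u w a by (simp add: vec_group_def mult_add_distrib_mat_vec)
    then show "x \<otimes>\<^bsub>vec_group n\<^esub> y \<in> mat_im a" using u w by (auto simp: mat_im_def dim)
  qed
  then show ?thesis by (rule normal_iff_subgroup[THEN iffD2])
qed

text \<open>
  A homomorphism on the cokernel is a homomorphism on vectors vanishing on the image, that is on the columns of \<open>a\<close>.
  The values on the classes of the unit vectors give the columns of \<open>F\<close>. Homomorphisms are merely additive here; that they
  are linear follows since the vectors on which two additive maps agree form a subgroup, which is everything once it contains the unit vectors.
\<close>

lemma card_Sur_cok: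
  fixes a :: "'p::prime_card mod_ring mat"
  assumes a: "a \<in> carrier_mat n n"
  shows "card (Sur (cok a) (vec_group r :: 'p mod_ring Matrix.vec monoid))
    = card {F \<in> full_rank r n. \<forall>j<n. kills r n F (\<lambda>i. a $$ (i, j))}"
proof -
  let ?V = "vec_group n :: 'p mod_ring Matrix.vec monoid"
  let ?W = "vec_group r :: 'p mod_ring Matrix.vec monoid"
  let ?H = "mat_im a"
  let ?co = "\<lambda>x. ?H #>\<^bsub>?V\<^esub> x"
  interpret V: comm_group ?V by (rule comm_group_vec_group)
  interpret N: normal ?H ?V by (rule mat_im_normal[OF a])
  have dim: "dim_row a = n" "dim_col a = n" using a by auto
  have cV: "carrier ?V = carrier_vec n" and cW: "carrier ?W = carrier_vec r" by (auto simp: vec_group_def)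
  have mV: "x \<otimes>\<^bsub>?V\<^esub> y = x + y" and mW: "u \<otimes>\<^bsub>?W\<^esub> w = u + w" for x y u w by (auto simp: vec_group_def)
  have ccok: "carrier (cok a) = ?co ` carrier_vec n"
    by (auto simp: cok_def dim FactGroup_def RCOSETS_def cV)
  have mcok: "?co x \<otimes>\<^bsub>cok a\<^esub> ?co y = ?co (x + y)" if "x \<in> carrier_vec n" "y \<in> carrier_vec n" for x y
    using that N.rcos_sum[of x y] by (simp add: cok_def dim FactGroup_def cV mV)
  have co_im: "?co h = ?co (0\<^sub>v n)" if "h \<in> ?H" for h
  proof -
    have "\<one>\<^bsub>?V\<^esub> = 0\<^sub>v n" by (simp add: vec_group_def)
    then have "0\<^sub>v n \<in> ?H" using N.one_closed by simp
    then show ?thesis using that N.subset V.coset_join2[OF _ N.is_subgroup] by auto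
  qed
  define S where "S = {F \<in> full_rank r n. \<forall>j<n. kills r n F (\<lambda>i. a $$ (i, j))}"
  define \<Psi> where "\<Psi> \<phi> = (\<lambda>i\<in>{..<n}. \<phi> (?co (unit_vec n i)))" for \<phi> :: "'p mod_ring Matrix.vec set \<Rightarrow> 'p mod_ring Matrix.vec"
  \<comment> \<open>A homomorphism is determined by the images of the unit vectors\<close>
  have lin_\<Psi>: "\<phi> (?co x) = comb r n (\<Psi> \<phi>) x" and \<Psi>G: "\<Psi> \<phi> \<in> {..<n} \<rightarrow>\<^sub>E carrier_vec r"
    if \<phi>: "\<phi> \<in> hom (cok a) ?W" and x: "x \<in> carrier_vec n" for \<phi> x
  proof -
    have cl: "\<phi> (?co y) \<in> carrier_vec r" if "y \<in> carrier_vec n" for y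
      using \<phi> that by (auto simp: hom_def ccok cW)
    show \<Psi>G: "\<Psi> \<phi> \<in> {..<n} \<rightarrow>\<^sub>E carrier_vec r" using cl by (auto simp: \<Psi>_def)
    have add: "\<phi> (?co (y + z)) = \<phi> (?co y) + \<phi> (?co z)" if "y \<in> carrier_vec n" "z \<in> carrier_vec n" for y z
    proof -
      have "\<phi> (?co y \<otimes>\<^bsub>cok a\<^esub> ?co z) = \<phi> (?co y) + \<phi> (?co z)"
        using \<phi> that by (auto simp: hom_def ccok mW)
      then show ?thesis by (simp only: mcok[OF that])
    qed
    let ?K = "{y \<in> carrier_vec n. \<phi> (?co y) = comb r n (\<Psi> \<phi>) y}"
    have "?K = carrier_vec n"
    proof (rule subgrp_eq_carrier)
      have "\<phi> (?co (0\<^sub>v n)) + \<phi> (?co (0\<^sub>v n)) = \<phi> (?co (0\<^sub>v n))" using add[of "0\<^sub>v n" "0\<^sub>v n"] by simp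
      then have "vec_index (\<phi> (?co (0\<^sub>v n))) k = 0" if "k < r" for k
        using that cl[of "0\<^sub>v n"] by (metis add_cancel_right_right carrier_vecD index_add_vec(1) zero_carrier_vec)
      then have "\<phi> (?co (0\<^sub>v n)) = 0\<^sub>v r" using cl[of "0\<^sub>v n"] by (intro eq_vecI) auto
      then show "vec_subgrp n ?K" by (auto simp: vec_subgrp_def comb_zero comb_add add)
      fix y :: "'p mod_ring Matrix.vec"
      assume y: "y \<in> carrier_vec n" and z: "\<And>u. u \<in> ?K \<Longrightarrow> scalar_prod u y = 0"
      have "vec_index y i = 0" if i: "i < n" for i
      proof -
        have "unit_vec n i \<in> ?K" using i \<Psi>G cl by (auto simp: comb_unit \<Psi>_def)
        then have "scalar_prod (unit_vec n i) y = 0" by (rule z)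
        then show ?thesis using y i by simp
      qed
      then show "y = 0\<^sub>v n" using y by (intro eq_vecI) auto
    qed
    then show "\<phi> (?co x) = comb r n (\<Psi> \<phi>) x" using x by blast
  qed
  have "bij_betw \<Psi> (Sur (cok a) ?W) S"
    unfolding bij_betw_def
  proof
    show "inj_on \<Psi> (Sur (cok a) ?W)"
    proof
      fix \<phi> \<psi> assume \<phi>: "\<phi> \<in> Sur (cok a) ?W" and \<psi>: "\<psi> \<in> Sur (cok a) ?W" and eq: "\<Psi> \<phi> = \<Psi> \<psi>"
      have "\<phi> C = \<psi> C" if C: "C \<in> carrier (cok a)" for C
      proof -
        obtain x where x: "x \<in> carrier_vec n" "C = ?co x" using C by (auto simp: ccok)
        have "\<phi> \<in> hom (cok a) ?W" "\<psi> \<in> hom (cok a) ?W" using \<phi> \<psi> by (auto simp: Sur_def epi_def)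
        from lin_\<Psi>[OF this(1) x(1)] lin_\<Psi>[OF this(2) x(1)] show ?thesis using eq x(2) by simp
      qed
      then show "\<phi> = \<psi>" using \<phi> \<psi> by (intro extensionalityI[of _ "carrier (cok a)"]) (auto simp: Sur_def)
    qed
    show "\<Psi> ` Sur (cok a) ?W = S"
    proof
      show "\<Psi> ` Sur (cok a) ?W \<subseteq> S"
      proof
        fix F assume "F \<in> \<Psi> ` Sur (cok a) ?W"
        then obtain \<phi> where \<phi>: "\<phi> \<in> Sur (cok a) ?W" "F = \<Psi> \<phi>" by blast
        have hom: "\<phi> \<in> hom (cok a) ?W" using \<phi> by (simp add: Sur_def epi_def)
        have F: "F \<in> {..<n} \<rightarrow>\<^sub>E carrier_vec r" using \<Psi>G[OF hom zero_carrier_vec] \<phi> by simp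
        have comb: "\<phi> (?co x) = comb r n F x" if "x \<in> carrier_vec n" for x using lin_\<Psi>[OF hom that] \<phi> by simp
        have "comb r n F ` carrier_vec n = \<phi> ` carrier (cok a)" unfolding ccok image_image
          by (intro image_cong refl) (simp add: comb)
        then have "F \<in> full_rank r n" using \<phi> F by (simp add: full_rank_iff_surj Sur_def epi_def cW)
        moreover have "kills r n F (\<lambda>i. a $$ (i, j))" if j: "j < n" for j
        proof -
          have colj: "col a j = a *\<^sub>v unit_vec n j" using a j by (intro eq_vecI) auto
          then have "col a j \<in> ?H" by (auto simp: mat_im_def dim)
          then have "comb r n F (col a j) = comb r n F (0\<^sub>v n)"
            using co_im[of "col a j"] comb[of "col a j"] comb[of "0\<^sub>v n"] a j by simp
          then have "comb r n F (col a j) = 0\<^sub>v r" by (simp add: comb_zero)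
          then show ?thesis using F j dim by (subst kills_iff_comb[where x="col a j"]) auto
        qed
        ultimately show "F \<in> S" by (simp add: S_def)
      qed
      show "S \<subseteq> \<Psi> ` Sur (cok a) ?W"
      proof
        fix F assume "F \<in> S"
        then have full: "F \<in> full_rank r n" and kill: "\<And>j. j < n \<Longrightarrow> kills r n F (\<lambda>i. a $$ (i, j))" by (auto simp: S_def)
        have F: "F \<in> {..<n} \<rightarrow>\<^sub>E carrier_vec r" using full by (simp add: full_rank_def)
        then have FG: "\<And>i. i < n \<Longrightarrow> F i \<in> carrier_vec r" by auto
        have linH: "comb r n F h = 0\<^sub>v r" if h: "h \<in> ?H" for h
        proof -
          obtain x where x: "x \<in> carrier_vec n" "h = a *\<^sub>v x" using h by (auto simp: mat_im_def dim)
          have "kills r n F (vec_index h)" unfolding kills_def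
          proof
            fix v :: "'p mod_ring Matrix.vec" assume v: "v \<in> carrier_vec r"
            have "(\<Sum>i<n. vec_index h i * scalar_prod v (F i))
              = (\<Sum>i<n. \<Sum>j<n. vec_index x j * (a $$ (i, j) * scalar_prod v (F i)))"
              using x dim by (intro sum.cong refl) (auto simp: scalar_prod_def sum_distrib_right atLeast0LessThan mult_ac intro!: sum.cong)
            also have "\<dots> = (\<Sum>j<n. vec_index x j * (\<Sum>i<n. a $$ (i, j) * scalar_prod v (F i)))"
              by (subst sum.swap) (simp add: sum_distrib_left)
            also have "\<dots> = 0" using kill v by (intro sum.neutral) (auto simp: kills_def)
            finally show "(\<Sum>i<n. vec_index h i * scalar_prod v (F i)) = 0" .
          qed
          then show ?thesis using FG by (subst kills_iff_comb[symmetric, where a="vec_index h"]) auto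
        qed
        \<comment> \<open>Any representative of the coset may be chosen, since \<open>comb r n F\<close> vanishes on the image of \<open>a\<close>.\<close>
        define \<phi> where "\<phi> = (\<lambda>C\<in>carrier (cok a). comb r n F (SOME y. y \<in> C))"
        have \<phi>: "\<phi> (?co x) = comb r n F x" if x: "x \<in> carrier_vec n" for x
        proof -
          have "x \<in> ?co x" using x by (intro V.rcos_self N.is_subgroup) (simp add: cV)
          then have "(SOME y. y \<in> ?co x) \<in> ?co x" by (rule someI)
          then obtain h where h: "h \<in> ?H" "(SOME y. y \<in> ?co x) = h + x" by (auto simp: r_coset_def mV)
          have "h \<in> carrier_vec n" using h N.subset by (auto simp: cV)
          then have "comb r n F (SOME y. y \<in> ?co x) = comb r n F x" using h x linH by (simp add: comb_add)
          then show ?thesis using x by (simp add: \<phi>_def ccok)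
        qed
        have "\<phi> \<in> hom (cok a) ?W"
          by (auto simp: hom_def ccok cW mW \<phi> mcok comb_add)
        moreover have "\<phi> ` carrier (cok a) = carrier ?W"
        proof -
          have "\<phi> ` carrier (cok a) = comb r n F ` carrier_vec n" unfolding ccok image_image
            by (intro image_cong refl) (simp add: \<phi>)
          then show ?thesis using full full_rank_iff_surj[OF F] by (simp add: cW)
        qed
        ultimately have "\<phi> \<in> Sur (cok a) ?W" by (simp add: Sur_def epi_def \<phi>_def)
        moreover have "\<Psi> \<phi> = F"
        proof (rule extensionalityI[of _ "{..<n}"])
          show "\<Psi> \<phi> \<in> extensional {..<n}" by (simp add: \<Psi>_def)
          show "F \<in> extensional {..<n}" using F by (simp add: PiE_def)
          show "\<Psi> \<phi> i = F i" if "i \<in> {..<n}" for i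
            using that FG[of i] by (simp add: \<Psi>_def \<phi> comb_unit)
        qed
        ultimately show "F \<in> \<Psi> ` Sur (cok a) ?W" by blast
      qed
    qed
  qed
  then show ?thesis unfolding S_def by (rule bij_betw_same_card)
qed

section \<open>The expected number of surjections\<close>

text \<open>
  The probability that \<open>F\<close> maps a random vector to 0, when the entries are independent with point probabilities \<open>q i\<close>.
\<close>

definition kill_prob :: "nat \<Rightarrow> nat \<Rightarrow> (nat \<Rightarrow> 'p::prime_card mod_ring \<Rightarrow> real)
    \<Rightarrow> (nat \<Rightarrow> 'p mod_ring Matrix.vec) \<Rightarrow> real" where
  "kill_prob r n q F = (\<Sum>a\<in>{..<n} \<rightarrow>\<^sub>E UNIV. if kills r n F a then \<Prod>i<n. q i (a i) else 0)"

lemma sum_add_char_kills: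
  fixes F :: "nat \<Rightarrow> 'p::prime_card mod_ring Matrix.vec"
  assumes F: "\<And>i. i < n \<Longrightarrow> F i \<in> carrier_vec r"
  shows "(\<Sum>v\<in>carrier_vec r. add_char (\<Sum>i<n. a i * scalar_prod v (F i)))
    = (if kills r n F a then of_nat (CARD('p) ^ r) else 0)"
proof -
  let ?y = "comb r n F (Matrix.vec n a)"
  have y: "scalar_prod v ?y = (\<Sum>i<n. a i * scalar_prod v (F i))" for v
    using F by (simp add: scalar_prod_comb)
  show ?thesis
  proof (cases "kills r n F a")
    case True
    then have "(\<Sum>v\<in>carrier_vec r. add_char (\<Sum>i<n. a i * scalar_prod v (F i))) = (\<Sum>v\<in>(carrier_vec r :: 'p mod_ring Matrix.vec set). 1)"
      by (intro sum.cong refl) (simp add: kills_def)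
    then show ?thesis using True by (simp add: card_vec)
  next
    case False
    then obtain w where "w \<in> carrier_vec r" "scalar_prod w ?y \<noteq> 0" by (auto simp: kills_def y)
    then have "(\<Sum>v\<in>carrier_vec r. add_char (1 * scalar_prod v ?y)) = 0"
      by (intro sum_add_char_subgrp[OF subgrp_carrier]) auto
    then show ?thesis using False by (simp add: y)
  qed
qed

lemma kill_prob_fourier:
  fixes F :: "nat \<Rightarrow> 'p::prime_card mod_ring Matrix.vec"
  assumes F: "\<And>i. i < n \<Longrightarrow> F i \<in> carrier_vec r"
  shows "complex_of_real (real (CARD('p) ^ r) * kill_prob r n q F)
    = (\<Sum>v\<in>carrier_vec r. \<Prod>i<n. char_fun (q i) (scalar_prod v (F i)))"
proof -
  have "complex_of_real (real (CARD('p) ^ r) * kill_prob r n q F)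
    = (\<Sum>a\<in>{..<n} \<rightarrow>\<^sub>E UNIV. (if kills r n F a then of_nat (CARD('p) ^ r) else 0) * (\<Prod>i<n. of_real (q i (a i))))"
    unfolding kill_prob_def of_real_mult of_real_sum sum_distrib_left
    by (intro sum.cong refl) auto
  also have "\<dots> = (\<Sum>a\<in>{..<n} \<rightarrow>\<^sub>E UNIV. \<Sum>v\<in>carrier_vec r. \<Prod>i<n. of_real (q i (a i)) * add_char (scalar_prod v (F i) * a i))"
  proof (intro sum.cong refl)
    fix a :: "nat \<Rightarrow> 'p mod_ring"
    have "(if kills r n F a then of_nat (CARD('p) ^ r) else 0) * (\<Prod>i<n. complex_of_real (q i (a i)))
      = (\<Sum>v\<in>carrier_vec r. (\<Prod>i<n. add_char (a i * scalar_prod v (F i))) * (\<Prod>i<n. of_real (q i (a i))))"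
      using sum_add_char_kills[of n F r a, OF F] by (simp only: sum_distrib_right[symmetric] add_char_sum)
    then show "(if kills r n F a then of_nat (CARD('p) ^ r) else 0) * (\<Prod>i<n. complex_of_real (q i (a i)))
      = (\<Sum>v\<in>carrier_vec r. \<Prod>i<n. of_real (q i (a i)) * add_char (scalar_prod v (F i) * a i))"
      by (simp add: prod.distrib mult_ac)
  qed
  also have "\<dots> = (\<Sum>v\<in>carrier_vec r. \<Sum>a\<in>{..<n} \<rightarrow>\<^sub>E UNIV. \<Prod>i<n. of_real (q i (a i)) * add_char (scalar_prod v (F i) * a i))"
    by (rule sum.swap)
  also have "\<dots> = (\<Sum>v\<in>carrier_vec r. \<Prod>i<n. char_fun (q i) (scalar_prod v (F i)))"
    unfolding char_fun_def by (intro sum.cong refl prod_sum_PiE[symmetric]) auto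
  finally show ?thesis .
qed

text \<open>
  In the Fourier expansion the zero frequency contributes exactly \<open>1 / L\<close>, and the others are bounded by the triangle
  inequality.
\<close>

lemma kill_prob_bounds:
  fixes F :: "nat \<Rightarrow> 'p::prime_card mod_ring Matrix.vec"
  assumes F: "\<And>i. i < n \<Longrightarrow> F i \<in> carrier_vec r" and q: "\<And>i. i < n \<Longrightarrow> (\<Sum>u\<in>UNIV. q i u) = 1"
    and char_fun: "\<And>i t. i < n \<Longrightarrow> norm (char_fun (q i) t) \<le> exp (- (m * gap (\<rho> i) t))"
  shows "kill_prob r n q F \<le> fourier_bound r n m \<rho> F"
    and "(1 - (\<Sum>v\<in>carrier_vec r - {0\<^sub>v r}. exp (- m * (\<Sum>i<n. gap (\<rho> i) (scalar_prod v (F i)))))) / real (CARD('p) ^ r)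
      \<le> kill_prob r n q F"
proof -
  let ?G = "carrier_vec r :: 'p mod_ring Matrix.vec set" and ?L = "real (CARD('p) ^ r)"
  let ?p = "\<lambda>v. \<Prod>i<n. char_fun (q i) (scalar_prod v (F i))"
  let ?e = "\<lambda>v. exp (- m * (\<Sum>i<n. gap (\<rho> i) (scalar_prod v (F i))))"
  have L: "0 < ?L" by simp
  have pe: "norm (?p v) \<le> ?e v" for v
  proof -
    have "norm (?p v) = (\<Prod>i<n. norm (char_fun (q i) (scalar_prod v (F i))))" by (simp add: prod_norm)
    also have "\<dots> \<le> (\<Prod>i<n. exp (- (m * gap (\<rho> i) (scalar_prod v (F i)))))"
      by (intro prod_mono) (auto intro: char_fun)
    also have "\<dots> = ?e v" by (simp add: sum_distrib_left sum_negf flip: exp_sum)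
    finally show ?thesis .
  qed
  have sum: "complex_of_real (?L * kill_prob r n q F) = (\<Sum>v\<in>?G. ?p v)"
    by (rule kill_prob_fourier) (rule F)
  have "?L * kill_prob r n q F \<le> norm (complex_of_real (?L * kill_prob r n q F))"
    by (simp only: norm_of_real)
  also have "\<dots> \<le> (\<Sum>v\<in>?G. ?e v)" unfolding sum by (rule sum_norm_le) (rule pe)
  finally show "kill_prob r n q F \<le> fourier_bound r n m \<rho> F"
    using L by (simp add: fourier_bound_def field_simps)
  have "char_fun (q i) 0 = 1" if "i < n" for i
    using arg_cong[OF q[OF that], of complex_of_real] by (simp add: char_fun_def)
  then have "?p (0\<^sub>v r) = 1" using F by (intro prod.neutral) simp
  then have "complex_of_real (?L * kill_prob r n q F - 1) = (\<Sum>v\<in>?G - {0\<^sub>v r}. ?p v)"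
    unfolding of_real_diff sum by (subst sum.remove[of _ "0\<^sub>v r"]) auto
  then have "norm (complex_of_real (?L * kill_prob r n q F - 1)) \<le> (\<Sum>v\<in>?G - {0\<^sub>v r}. ?e v)"
    by (simp only:) (rule sum_norm_le, rule pe)
  then have "\<bar>?L * kill_prob r n q F - 1\<bar> \<le> (\<Sum>v\<in>?G - {0\<^sub>v r}. ?e v)" by (simp only: norm_of_real)
  then have "1 - (\<Sum>v\<in>?G - {0\<^sub>v r}. ?e v) \<le> ?L * kill_prob r n q F" by linarith
  then show "(1 - (\<Sum>v\<in>?G - {0\<^sub>v r}. ?e v)) / ?L \<le> kill_prob r n q F"
    using L by (simp add: field_simps)
qed

lemma sets_Collect_mat:
  assumes A: "A \<in> M \<rightarrow>\<^sub>M count_space (carrier_mat n n)"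
  shows "{\<omega> \<in> space M. P (A \<omega>)} \<in> sets M"
proof -
  have "A \<omega> \<in> carrier_mat n n" if "\<omega> \<in> space M" for \<omega>
    using measurable_space[OF A that] by simp
  then have "{\<omega> \<in> space M. P (A \<omega>)} = A -` {a \<in> carrier_mat n n. P a} \<inter> space M" by blast
  also have "\<dots> \<in> sets M" using A by (rule measurable_sets) auto
  finally show ?thesis .
qed

text \<open>
  The event is decomposed according to the values of all entries; the product formula then splits into columns because
  both the probability of a matrix and the condition on it do.
\<close>

lemma (in prob_space) prob_kills:
  fixes A :: "'a \<Rightarrow> 'p::prime_card mod_ring mat"
  assumes A: "A \<in> M \<rightarrow>\<^sub>M count_space (carrier_mat n n)" and n: "0 < n"
    and ind: "indep_vars (\<lambda>_. count_space UNIV) (\<lambda>(i, j) \<omega>. A \<omega> $$ (i, j)) ({..<n} \<times> {..<n})"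
  shows "prob {\<omega> \<in> space M. \<forall>j<n. kills r n F (\<lambda>i. A \<omega> $$ (i, j))}
    = (\<Prod>j<n. kill_prob r n (\<lambda>i u. prob {\<omega> \<in> space M. A \<omega> $$ (i, j) = u}) F)"
proof -
  let ?q = "\<lambda>i j u. prob {\<omega> \<in> space M. A \<omega> $$ (i, j) = u}"
  let ?B = "{..<n} \<rightarrow>\<^sub>E ({..<n} \<rightarrow>\<^sub>E (UNIV :: 'p mod_ring set))"
  let ?E = "\<lambda>b. {\<omega> \<in> space M. \<forall>j<n. \<forall>i<n. A \<omega> $$ (i, j) = b j i}"
  let ?Bk = "{b \<in> ?B. \<forall>j<n. kills r n F (b j)}"
  have finB: "finite ?B" by (intro finite_PiE) auto
  have pE: "prob (?E b) = (\<Prod>j<n. \<Prod>i<n. ?q i j (b j i))" for b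
  proof -
    let ?X = "\<lambda>(i, j) \<omega>. A \<omega> $$ (i, j)"
    have inter: "?E b = (\<Inter>x\<in>{..<n} \<times> {..<n}. ?X x -` {b (snd x) (fst x)} \<inter> space M)"
    proof (intro equalityI subsetI)
      fix \<omega> assume \<omega>: "\<omega> \<in> (\<Inter>x\<in>{..<n} \<times> {..<n}. ?X x -` {b (snd x) (fst x)} \<inter> space M)"
      then have all: "\<omega> \<in> ?X (i, j) -` {b j i} \<inter> space M" if "i < n" "j < n" for i j 
        using INT_D[OF \<omega>, of "(i, j)"] that by simp
      show "\<omega> \<in> ?E b" using all[OF n n] all by simp
    qed auto
    have "prob (?E b) = (\<Prod>x\<in>{..<n} \<times> {..<n}. prob (?X x -` {b (snd x) (fst x)} \<inter> space M))"
      unfolding inter using n by (intro indep_varsD_finite[OF ind]) auto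
    also have "\<dots> = (\<Prod>x\<in>{..<n} \<times> {..<n}. ?q (fst x) (snd x) (b (snd x) (fst x)))"
    proof (intro prod.cong refl)
      fix x :: "nat \<times> nat"
      show "prob (?X x -` {b (snd x) (fst x)} \<inter> space M) = ?q (fst x) (snd x) (b (snd x) (fst x))"
        by (cases x) (auto intro!: arg_cong[where f=prob])
    qed
    also have "\<dots> = (\<Prod>i<n. \<Prod>j<n. ?q i j (b j i))"
      by (simp add: prod.cartesian_product case_prod_unfold)
    also have "\<dots> = (\<Prod>j<n. \<Prod>i<n. ?q i j (b j i))" by (rule prod.swap)
    finally show ?thesis .
  qed
  have kc: "kills r n F a = kills r n F a'" if "\<And>i. i < n \<Longrightarrow> a i = a' i" for a a'
    using that by (simp add: kills_def)
  have decomp: "{\<omega> \<in> space M. \<forall>j<n. kills r n F (\<lambda>i. A \<omega> $$ (i, j))} = (\<Union>b\<in>?Bk. ?E b)"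
  proof (intro equalityI subsetI)
    fix \<omega> assume \<omega>: "\<omega> \<in> {\<omega> \<in> space M. \<forall>j<n. kills r n F (\<lambda>i. A \<omega> $$ (i, j))}"
    define b where "b = (\<lambda>j\<in>{..<n}. \<lambda>i\<in>{..<n}. A \<omega> $$ (i, j))"
    have "kills r n F (b j)" if "j < n" for j
      using \<omega> that kc[of "b j" "\<lambda>i. A \<omega> $$ (i, j)"] by (simp add: b_def)
    then have "b \<in> ?Bk" by (auto simp: b_def)
    moreover have "\<omega> \<in> ?E b" using \<omega> by (simp add: b_def)
    ultimately show "\<omega> \<in> (\<Union>b\<in>?Bk. ?E b)" by blast
  next
    fix \<omega> assume "\<omega> \<in> (\<Union>b\<in>?Bk. ?E b)"
    then obtain b where b: "b \<in> ?Bk" "\<omega> \<in> ?E b" by blast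
    then have "kills r n F (\<lambda>i. A \<omega> $$ (i, j))" if "j < n" for j
      using that kc[of "\<lambda>i. A \<omega> $$ (i, j)" "b j"] by simp
    then show "\<omega> \<in> {\<omega> \<in> space M. \<forall>j<n. kills r n F (\<lambda>i. A \<omega> $$ (i, j))}" using b by simp
  qed
  have "prob {\<omega> \<in> space M. \<forall>j<n. kills r n F (\<lambda>i. A \<omega> $$ (i, j))} = (\<Sum>b\<in>?Bk. prob (?E b))"
    unfolding decomp
  proof (rule finite_measure_finite_Union)
    show "finite ?Bk" using finB by simp
    show "?E ` ?Bk \<subseteq> events"
      by (intro image_subsetI sets_Collect_mat[OF A, where P="\<lambda>a. \<forall>j<n. \<forall>i<n. a $$ (i, j) = b j i" for b])
    show "disjoint_family_on ?E ?Bk"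
    proof (unfold disjoint_family_on_def, intro ballI impI)
      fix b b' assume b: "b \<in> ?Bk" "b' \<in> ?Bk" "b \<noteq> b'"
      have "b = b'" if "\<omega> \<in> ?E b" "\<omega> \<in> ?E b'" for \<omega>
      proof (rule PiE_ext[of b "{..<n}" "\<lambda>_. {..<n} \<rightarrow>\<^sub>E UNIV" b'])
        fix j assume j: "j \<in> {..<n}"
        show "b j = b' j"
        proof (rule PiE_ext[of "b j" "{..<n}" "\<lambda>_. UNIV" "b' j"])
          show "b j i = b' j i" if i: "i \<in> {..<n}" for i
          proof -
            have "A \<omega> $$ (i, j) = b j i" "A \<omega> $$ (i, j) = b' j i"
              using \<open>\<omega> \<in> ?E b\<close> \<open>\<omega> \<in> ?E b'\<close> i j by auto
            then show ?thesis by simp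
          qed
        qed (use b j in auto)
      qed (use b in auto)
      then show "?E b \<inter> ?E b' = {}" using b(3) by blast
    qed
  qed
  also have "\<dots> = (\<Sum>b\<in>?B. if \<forall>j<n. kills r n F (b j) then \<Prod>j<n. \<Prod>i<n. ?q i j (b j i) else 0)"
    unfolding pE using finB by (intro sum.mono_neutral_cong_left) auto
  also have "\<dots> = (\<Sum>b\<in>?B. \<Prod>j<n. if kills r n F (b j) then \<Prod>i<n. ?q i j (b j i) else 0)"
  proof (intro sum.cong refl)
    fix b
    show "(if \<forall>j<n. kills r n F (b j) then \<Prod>j<n. \<Prod>i<n. ?q i j (b j i) else 0)
      = (\<Prod>j<n. if kills r n F (b j) then \<Prod>i<n. ?q i j (b j i) else 0)"
    proof (cases "\<forall>j<n. kills r n F (b j)")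
      case True then show ?thesis by simp
    next
      case False
      then obtain j where "j < n" "\<not> kills r n F (b j)" by blast
      then have "(\<Prod>j<n. if kills r n F (b j) then \<Prod>i<n. ?q i j (b j i) else 0) = 0"
        by (intro prod_zero) auto
      then show ?thesis using False by simp
    qed
  qed
  also have "\<dots> = (\<Prod>j<n. kill_prob r n (\<lambda>i. ?q i j) F)"
    unfolding kill_prob_def by (rule prod_sum_PiE[symmetric]) (auto intro: finite_PiE)
  finally show ?thesis .
qed

lemma finite_full_rank: "finite (full_rank r n :: (nat \<Rightarrow> 'p::prime_card mod_ring Matrix.vec) set)"
proof (rule finite_subset)
  show "(full_rank r n :: (nat \<Rightarrow> 'p mod_ring Matrix.vec) set) \<subseteq> {..<n} \<rightarrow>\<^sub>E carrier_vec r" by (auto simp: full_rank_def)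
  show "finite ({..<n} \<rightarrow>\<^sub>E (carrier_vec r :: 'p mod_ring Matrix.vec set))" by (intro finite_PiE) auto
qed

lemma (in prob_space) expectation_card_Sur:
  fixes A :: "'a \<Rightarrow> 'p::prime_card mod_ring mat"
  assumes A: "A \<in> M \<rightarrow>\<^sub>M count_space (carrier_mat n n)" and n: "0 < n"
    and ind: "indep_vars (\<lambda>_. count_space UNIV) (\<lambda>(i, j) \<omega>. A \<omega> $$ (i, j)) ({..<n} \<times> {..<n})"
  shows "expectation (\<lambda>\<omega>. real (card (Sur (cok (A \<omega>)) (vec_group r :: 'p mod_ring Matrix.vec monoid))))
    = (\<Sum>F\<in>full_rank r n. \<Prod>j<n. kill_prob r n (\<lambda>i u. prob {\<omega> \<in> space M. A \<omega> $$ (i, j) = u}) F)"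
proof -
  let ?R = "full_rank r n :: (nat \<Rightarrow> 'p mod_ring Matrix.vec) set"
  let ?E = "\<lambda>F. {\<omega> \<in> space M. \<forall>j<n. kills r n F (\<lambda>i. A \<omega> $$ (i, j))}"
  have meas: "?E F \<in> events" for F by (rule sets_Collect_mat[OF A])
  have "expectation (\<lambda>\<omega>. real (card (Sur (cok (A \<omega>)) (vec_group r :: 'p mod_ring Matrix.vec monoid))))
    = expectation (\<lambda>\<omega>. \<Sum>F\<in>?R. indicator (?E F) \<omega>)"
  proof (rule Bochner_Integration.integral_cong[OF refl])
    fix \<omega> assume \<omega>: "\<omega> \<in> space M"
    then have a: "A \<omega> \<in> carrier_mat n n" using measurable_space[OF A] by auto
    show "real (card (Sur (cok (A \<omega>)) (vec_group r :: 'p mod_ring Matrix.vec monoid))) = (\<Sum>F\<in>?R. indicator (?E F) \<omega>)"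
      using \<omega> by (simp add: finite_full_rank card_Sur_cok[OF a] indicator_def of_bool_def sum.If_cases Int_def)
  qed
  also have "\<dots> = (\<Sum>F\<in>?R. prob (?E F))"
  proof -
    have int: "integrable M (indicator (?E F) :: 'a \<Rightarrow> real)" for F
      by (rule integrable_real_indicator[OF meas]) (simp only: emeasure_eq_measure infinity_ennreal_def ennreal_less_top)
    have "expectation (\<lambda>\<omega>. \<Sum>F\<in>?R. indicator (?E F) \<omega>) = (\<Sum>F\<in>?R. expectation (indicator (?E F) :: 'a \<Rightarrow> real))"
      by (rule Bochner_Integration.integral_sum) (rule int)
    also have "\<dots> = (\<Sum>F\<in>?R. prob (?E F))"
    proof (intro sum.cong refl)
      fix F
      have "?E F \<inter> space M = ?E F" by blast
      then show "expectation (indicator (?E F) :: 'a \<Rightarrow> real) = prob (?E F)"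
        by (simp only: Bochner_Integration.integral_indicator)
    qed
    finally show ?thesis .
  qed
  also have "\<dots> = (\<Sum>F\<in>?R. \<Prod>j<n. kill_prob r n (\<lambda>i u. prob {\<omega> \<in> space M. A \<omega> $$ (i, j) = u}) F)"
    by (intro sum.cong refl prob_kills[OF A n ind])
  finally show ?thesis .
qed

lemma balanced_expectation_bounds:
  fixes A :: "'w \<Rightarrow> 'p::prime_card mod_ring mat" and n r :: nat and \<alpha> \<epsilon> \<kappa> L m s e :: real
  assumes bal: "balanced_mat \<alpha> n M A" and n: "0 < n" and \<alpha>: "0 < \<alpha>" "\<alpha> \<le> 1 / 2"
    and \<epsilon>: "0 < \<epsilon>" "\<epsilon> < 1" and \<kappa>: "0 < \<kappa>" "\<And>x :: 'p mod_ring. x \<noteq> 0 \<Longrightarrow> \<kappa> \<le> 1 - Re (add_char x)"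
  defines "L \<equiv> real (CARD('p) ^ r)" and "m \<equiv> \<alpha> * (1 - \<alpha>)"
  assumes s: "0 \<le> s" "L * s \<le> \<epsilon> / 2 * n" and small: "L * exp (- m * ((1 - \<epsilon>) * n)) \<le> 1"
  defines "e \<equiv> prob_space.expectation M (\<lambda>\<omega>. real (card (Sur (cok (A \<omega>)) (vec_group r :: 'p mod_ring Matrix.vec monoid))))"
  shows "(1 - n * L * exp (- \<epsilon>\<^sup>2 / 16 * n)) * (1 - L * exp (- m * ((1 - \<epsilon>) * n))) ^ n \<le> e"
    and "e \<le> main_factor L n m \<epsilon> (\<kappa> * s) * (1 + 2 ^ (CARD('p) ^ r) *
        (\<Sum>I | I \<subseteq> {..<n} \<and> I \<noteq> {} \<and> real (card I) \<le> L * s. ((1 + exp (- 2 * m * card I)) / 2) ^ n * L ^ card I))"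
proof -
  interpret prob_space M using bal by (simp add: balanced_mat_def random_mat_def)
  have A: "A \<in> M \<rightarrow>\<^sub>M count_space (carrier_mat n n)"
    and ind: "indep_vars (\<lambda>_. count_space UNIV) (\<lambda>(i, j) \<omega>. A \<omega> $$ (i, j)) ({..<n} \<times> {..<n})"
    using bal by (auto simp: balanced_mat_def random_mat_def)
  define q where "q = (\<lambda>j i u. prob {\<omega> \<in> space M. A \<omega> $$ (i, j) = u})"
  have q0: "0 \<le> q j i u" for i j u by (simp add: q_def)
  have q1: "(\<Sum>u\<in>UNIV. q j i u) = 1" if ij: "i < n" "j < n" for i j
  proof -
    have rv: "(\<lambda>\<omega>. A \<omega> $$ (i, j)) \<in> M \<rightarrow>\<^sub>M count_space UNIV"
      using ind ij by (auto simp: indep_vars_def)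
    have "(\<Sum>u\<in>UNIV. q j i u) = prob (\<Union>u. {\<omega> \<in> space M. A \<omega> $$ (i, j) = u})"
      unfolding q_def
    proof (rule finite_measure_finite_Union[symmetric])
      show "range (\<lambda>u. {\<omega> \<in> space M. A \<omega> $$ (i, j) = u}) \<subseteq> events"
      proof
        fix E assume "E \<in> range (\<lambda>u. {\<omega> \<in> space M. A \<omega> $$ (i, j) = u})"
        then obtain u where "E = (\<lambda>\<omega>. A \<omega> $$ (i, j)) -` {u} \<inter> space M" by auto
        then show "E \<in> events" using measurable_sets[OF rv, of "{u}"] by simp
      qed
    qed (auto simp: disjoint_family_on_def)
    also have "(\<Union>u. {\<omega> \<in> space M. A \<omega> $$ (i, j) = u}) = space M" by auto
    finally show ?thesis by (simp add: prob_space)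
  qed
  have qa: "q j i u \<le> 1 - \<alpha>" if "i < n" "j < n" for i j u
    using bal that by (auto simp: balanced_mat_def balanced_elem_def q_def)
  define \<rho> where "\<rho> j i = (SOME \<rho>. step_dist \<rho> \<and> (\<forall>t. norm (char_fun (q j i) t) \<le> exp (- (m * gap \<rho> t))))" for j i
  have \<rho>': "step_dist (\<rho> j i) \<and> (\<forall>t. norm (char_fun (q j i) t) \<le> exp (- (m * gap (\<rho> j i) t)))" if "i < n" "j < n" for i j
  proof -
    have "\<exists>\<rho>. step_dist \<rho> \<and> (\<forall>t. norm (char_fun (q j i) t) \<le> exp (- (m * gap \<rho> t)))"
      unfolding m_def using that by (intro char_fun_le_exp_gap q0 q1 qa \<alpha>)
    then show ?thesis unfolding \<rho>_def by (rule someI_ex)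
  qed
  then have \<rho>: "\<And>i j. i < n \<Longrightarrow> j < n \<Longrightarrow> step_dist (\<rho> j i)"
    "\<And>i j t. i < n \<Longrightarrow> j < n \<Longrightarrow> norm (char_fun (q j i) t) \<le> exp (- (m * gap (\<rho> j i) t))"
    by blast+
  have m: "0 \<le> m" using \<alpha> by (simp add: m_def)
  have e: "e = (\<Sum>F\<in>full_rank r n. \<Prod>j<n. kill_prob r n (q j) F)"
    unfolding e_def q_def by (rule expectation_card_Sur[OF A n ind])
  have k0: "0 \<le> kill_prob r n (q j) F" for j F
    unfolding kill_prob_def by (intro sum_nonneg) (auto intro: prod_nonneg q0)
  show "(1 - n * L * exp (- \<epsilon>\<^sup>2 / 16 * n)) * (1 - L * exp (- m * ((1 - \<epsilon>) * n))) ^ n \<le> e"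
    unfolding e L_def
  proof (rule sum_full_rank_ge[where \<rho>=\<rho>])
    fix F :: "nat \<Rightarrow> 'p mod_ring Matrix.vec" and j
    assume "j < n" and F: "F \<in> {..<n} \<rightarrow>\<^sub>E carrier_vec r"
    then show "(1 - (\<Sum>v\<in>carrier_vec r - {0\<^sub>v r}. exp (- m * (\<Sum>i<n. gap (\<rho> j i) (scalar_prod v (F i)))))) / real (CARD('p) ^ r)
      \<le> kill_prob r n (q j) F"
      using \<rho> q1 by (intro kill_prob_bounds(2)) auto
  qed (use \<rho> \<epsilon> m n small k0 in \<open>auto simp: L_def\<close>)
  have "e \<le> (\<Sum>F\<in>full_rank r n. \<Prod>j<n. fourier_bound r n m (\<rho> j) F)"
    unfolding e
  proof (intro sum_mono prod_mono conjI k0)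
    fix F :: "nat \<Rightarrow> 'p mod_ring Matrix.vec" and j
    assume "F \<in> full_rank r n" "j \<in> {..<n}"
    then show "kill_prob r n (q j) F \<le> fourier_bound r n m (\<rho> j) F"
      using \<rho> q1 by (intro kill_prob_bounds(1)) (auto simp: full_rank_def)
  qed
  also have "\<dots> \<le> main_factor L n m \<epsilon> (\<kappa> * s) * (1 + 2 ^ (CARD('p) ^ r) *
        (\<Sum>I | I \<subseteq> {..<n} \<and> I \<noteq> {} \<and> real (card I) \<le> L * s. ((1 + exp (- 2 * m * card I)) / 2) ^ n * L ^ card I))"
    using s unfolding L_def by (intro sum_full_rank_le \<rho> \<epsilon> m \<kappa>)
  finally show "e \<le> main_factor L n m \<epsilon> (\<kappa> * s) * (1 + 2 ^ (CARD('p) ^ r) *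
        (\<Sum>I | I \<subseteq> {..<n} \<and> I \<noteq> {} \<and> real (card I) \<le> L * s. ((1 + exp (- 2 * m * card I)) / 2) ^ n * L ^ card I))" .
qed

theorem theorem1p4:
  fixes c :: real
    and M :: "nat \<Rightarrow> 'w measure"
    and A :: "nat \<Rightarrow> 'w \<Rightarrow> 'p::prime_card mod_ring mat"
    and r :: nat
  assumes "c > 1"
    and "\<And>n. n \<ge> 1 \<Longrightarrow> random_mat n (M n) (A n)"
    and "\<forall>\<^sub>F n in sequentially. balanced_mat (c * ln (real n) / real n) n (M n) (A n)"
  shows "(\<lambda>n. prob_space.expectation (M n)
            (\<lambda>\<omega>. real (card (Sur (cok (A n \<omega>)) (vec_group r :: 'p mod_ring Matrix.vec monoid)))))
         \<longlonglongrightarrow> 1"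
proof -
  obtain \<kappa> :: real where \<kappa>: "0 < \<kappa>" "\<And>x :: 'p mod_ring. x \<noteq> 0 \<Longrightarrow> \<kappa> \<le> 1 - Re (add_char x)"
    using ex_add_char_gap[where 'p='p] by blast
  define L where "L = real (CARD('p) ^ r)"
  define \<alpha> where "\<alpha> n = c * ln (real n) / real n" for n
  have L: "1 \<le> L"
  proof -
    have "1 \<le> CARD('p) ^ r" using zero_less_card_finite[where 'a='p] by (simp add: Suc_le_eq)
    then have "real 1 \<le> L" unfolding L_def by (rule of_nat_mono)
    then show ?thesis by simp
  qed
  obtain \<epsilon> \<delta> :: real where \<epsilon>: "0 < \<epsilon>" "\<epsilon> < 1" and \<delta>: "0 < \<delta>" "L * \<delta> \<le> \<epsilon> / 2"
    and small: "\<forall>\<^sub>F n in sequentially. L * exp (- (\<alpha> n * (1 - \<alpha> n)) * ((1 - \<epsilon>) * n)) \<le> 1"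
    and low: "(\<lambda>n. (1 - n * L * exp (- \<epsilon>\<^sup>2 / 16 * n)) * (1 - L * exp (- (\<alpha> n * (1 - \<alpha> n)) * ((1 - \<epsilon>) * n))) ^ n) \<longlonglongrightarrow> 1"
    and up: "(\<lambda>n. main_factor L n (\<alpha> n * (1 - \<alpha> n)) \<epsilon> (\<kappa> * (\<delta> * n)) * (1 + 2 ^ (CARD('p) ^ r) *
       (\<Sum>I | I \<subseteq> {..<n} \<and> I \<noteq> {} \<and> real (card I) \<le> L * (\<delta> * n).
          ((1 + exp (- 2 * (\<alpha> n * (1 - \<alpha> n)) * card I)) / 2) ^ n * L ^ card I))) \<longlonglongrightarrow> 1"
    using threshold_parameters[OF assms(1) \<kappa>(1) L zero_le_power[OF zero_le_numeral, of "Num.Bit0 Num.One" "CARD('p) ^ r"], folded \<alpha>_def]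
    by (elim exE conjE) (rule that, assumption+)
  have "\<alpha> \<longlonglongrightarrow> 0" unfolding \<alpha>_def by real_asymp
  then have "\<forall>\<^sub>F n in sequentially. \<alpha> n < 1 / 2" by (rule order_tendstoD) simp
  then have bounds: "\<forall>\<^sub>F n in sequentially.
      (1 - n * L * exp (- \<epsilon>\<^sup>2 / 16 * n)) * (1 - L * exp (- (\<alpha> n * (1 - \<alpha> n)) * ((1 - \<epsilon>) * n))) ^ n
      \<le> prob_space.expectation (M n) (\<lambda>\<omega>. real (card (Sur (cok (A n \<omega>)) (vec_group r :: 'p mod_ring Matrix.vec monoid))))
    \<and> prob_space.expectation (M n) (\<lambda>\<omega>. real (card (Sur (cok (A n \<omega>)) (vec_group r :: 'p mod_ring Matrix.vec monoid))))
      \<le> main_factor L n (\<alpha> n * (1 - \<alpha> n)) \<epsilon> (\<kappa> * (\<delta> * n)) * (1 + 2 ^ (CARD('p) ^ r) *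
       (\<Sum>I | I \<subseteq> {..<n} \<and> I \<noteq> {} \<and> real (card I) \<le> L * (\<delta> * n).
          ((1 + exp (- 2 * (\<alpha> n * (1 - \<alpha> n)) * card I)) / 2) ^ n * L ^ card I))"
    using small assms(3) eventually_gt_at_top[of 1]
  proof eventually_elim
    case (elim n)
    have \<alpha>: "0 < \<alpha> n" "\<alpha> n \<le> 1 / 2" using elim assms(1) by (auto simp: \<alpha>_def)
    have bal: "balanced_mat (\<alpha> n) n (M n) (A n)" using elim by (simp add: \<alpha>_def)
    have n: "0 < n" using elim by simp
    have s: "0 \<le> \<delta> * n" "L * (\<delta> * n) \<le> \<epsilon> / 2 * n"
      using \<delta> mult_right_mono[OF \<delta>(2), of "real n"] by (auto simp: mult_ac)
    have sm: "L * exp (- (\<alpha> n * (1 - \<alpha> n)) * ((1 - \<epsilon>) * n)) \<le> 1" using elim by simp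
    show ?case
      unfolding L_def
      by (intro conjI balanced_expectation_bounds[OF bal n \<alpha> \<epsilon> \<kappa> s(1) s(2)[unfolded L_def] sm[unfolded L_def]])
  qed
  show ?thesis
    by (rule tendsto_sandwich[OF _ _ low up]) (use bounds in \<open>auto elim: eventually_mono\<close>)
qed

end
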